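(* Let $\mathcal{F}$ be a Fréchet space of entire maps $\mathbb{C}\to\mathbb{C}$ that contains all complex polynomial maps and whose topology is finer than the topology of local uniform convergence on $\mathbb{C}$. Let $E$ be a countable dense subset of $\mathbb{C}$ and let $\Lambda$ be a dense subset of $\mathbb{C}$. Then the set of $f\in\mathcal{F}$ such that (1) $f^{-1}(E)=E$, (2) every periodic point of $f$ lies in $E$, (3) the multiplier of $f$ at each of its cycles lies in $\Lambda$, is dense in $\mathcal{F}$.
   Context: For an entire map $f$ and a cycle $\{z, f(z),\dots,f^{\circ(n-1)}(z)\}$ of exact period $n$, the multiplier of $f$ at this cycle is $(f^{\circ n})'(z)$. *)

theory Defs
  imports "HOL-Complex_Analysis.Complex_Analysis" "HOL-Computational_Algebra.Polynomial"
begin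

definition is_seminorm_on :: "(complex \<Rightarrow> complex) set \<Rightarrow> ((complex \<Rightarrow> complex) \<Rightarrow> real) \<Rightarrow> bool" where
  "is_seminorm_on F q \<longleftrightarrow>
     (\<forall>f\<in>F. q f \<ge> 0) \<and>
     (\<forall>f\<in>F. \<forall>c::complex. q (\<lambda>z. c * f z) = cmod c * q f) \<and>
     (\<forall>f\<in>F. \<forall>g\<in>F. q (\<lambda>z. f z + g z) \<le> q f + q g)"

definition frechet_entire_space :: "(complex \<Rightarrow> complex) set \<Rightarrow> (nat \<Rightarrow> (complex \<Rightarrow> complex) \<Rightarrow> real) \<Rightarrow> bool" where
  "frechet_entire_space F p \<longleftrightarrow>
     (\<forall>f\<in>F. f holomorphic_on UNIV) \<and>
     (\<lambda>z. 0) \<in> F \<and>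
     (\<forall>f\<in>F. \<forall>g\<in>F. (\<lambda>z. f z + g z) \<in> F) \<and>
     (\<forall>f\<in>F. \<forall>c::complex. (\<lambda>z. c * f z) \<in> F) \<and>
     (\<forall>n. is_seminorm_on F (p n)) \<and>
     (\<forall>f\<in>F. (\<forall>n. p n f = 0) \<longrightarrow> f = (\<lambda>z. 0)) \<and>
     (\<forall>x. (\<forall>i. x i \<in> F) \<longrightarrow>
        (\<forall>n. \<forall>e>0. \<exists>M. \<forall>i\<ge>M. \<forall>j\<ge>M. p n (\<lambda>z. x i z - x j z) < e) \<longrightarrow>
        (\<exists>g\<in>F. \<forall>n. (\<lambda>i. p n (\<lambda>z. x i z - g z)) \<longlonglongrightarrow> 0))"

text \<open>The topology of F is finer than local uniform convergence: the inclusion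
of F into the entire functions with the compact-open topology is continuous
(continuity at 0 suffices, by linearity).\<close>

definition finer_than_local_uniform :: "(complex \<Rightarrow> complex) set \<Rightarrow> (nat \<Rightarrow> (complex \<Rightarrow> complex) \<Rightarrow> real) \<Rightarrow> bool" where
  "finer_than_local_uniform F p \<longleftrightarrow>
     (\<forall>K. compact K \<longrightarrow> (\<forall>e>0. \<exists>N. \<exists>d>0. \<forall>f\<in>F.
        (\<forall>n\<le>N. p n f < d) \<longrightarrow> (\<forall>z\<in>K. cmod (f z) < e)))"

definition dense_in_frechet :: "(complex \<Rightarrow> complex) set \<Rightarrow> (nat \<Rightarrow> (complex \<Rightarrow> complex) \<Rightarrow> real) \<Rightarrow> (complex \<Rightarrow> complex) set \<Rightarrow> bool" where
  "dense_in_frechet F p S \<longleftrightarrow> S \<subseteq> F \<and>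
     (\<forall>g\<in>F. \<forall>N. \<forall>e>0. \<exists>f\<in>S. \<forall>n\<le>N. p n (\<lambda>z. f z - g z) < e)"

definition periodic_point :: "(complex \<Rightarrow> complex) \<Rightarrow> complex \<Rightarrow> bool" where
  "periodic_point f z \<longleftrightarrow> (\<exists>n>0. (f ^^ n) z = z)"

definition exact_period :: "(complex \<Rightarrow> complex) \<Rightarrow> complex \<Rightarrow> nat" where
  "exact_period f z = (LEAST n. n > 0 \<and> (f ^^ n) z = z)"

definition multiplier :: "(complex \<Rightarrow> complex) \<Rightarrow> complex \<Rightarrow> complex" where
  "multiplier f z = deriv (f ^^ exact_period f z) z"

end

theory Submission
  imports Defs
begin

text \<open>
  The map is a limit of \<^term>\<open>f k\<close> with finite marked sets \<^term>\<open>A k\<close>: the marked points lie in \<^term>\<open>E\<close>,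
  are mapped into \<^term>\<open>E\<close> with nonzero derivative, and all cycles consisting of marked points have a
  multiplier in \<^term>\<open>\<Lambda>\<close>. Each step adds a small polynomial vanishing to second order at the marked points, found by
  Hermite interpolation, and either marks a point of \<^term>\<open>E\<close>, or moves an \<^term>\<open>e\<close>-point lying in a basic
  open set into \<^term>\<open>E\<close> and marks it, or does the same with a whole cycle while adjusting its multiplier.
  Every such task recurs infinitely often. By Hurwitz's theorem an \<^term>\<open>e\<close>-point (periodic point) of the limit
  is a limit of \<^term>\<open>e\<close>-points (periodic points) of \<^term>\<open>f k\<close>, and since it is isolated, a task for a small
  neighbourhood forces it to be marked.

  Hurwitz's theorem needs that no iterate of the limit is the identity. This comes for free when the multipliers
  0 and those of modulus 1 are removed from the dense set: if an iterate were the identity, the marked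
  points would be periodic with roots of unity as multipliers.
\<close>

section \<open>Orbits and multipliers\<close>

definition orbit :: "('a \<Rightarrow> 'a) \<Rightarrow> 'a \<Rightarrow> 'a set" where
  "orbit f a = range (\<lambda>i. (f ^^ i) a)"

lemma self_in_orbit: "a \<in> orbit f a"
  unfolding orbit_def by (rule range_eqI[of _ _ 0]) simp

lemma funpow_in_orbit: "(f ^^ i) a \<in> orbit f a"
  unfolding orbit_def by blast

lemma image_in_orbit:
  assumes "x \<in> orbit f a"
  shows "f x \<in> orbit f a"
proof -
  obtain i where "x = (f ^^ i) a"
    using assms unfolding orbit_def by blast
  then have "f x = (f ^^ Suc i) a"
    by simp
  then show ?thesis
    using funpow_in_orbit by metis
qed

lemma orbit_subset:
  assumes "a \<in> S" "f ` S \<subseteq> S"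
  shows "orbit f a \<subseteq> S"
proof -
  have "(f ^^ i) a \<in> S" for i
    by (induction i) (use assms in auto)
  then show ?thesis
    unfolding orbit_def by blast
qed

text \<open>The relation is required only along one orbit, because a perturbed map is controlled
  only at finitely many points. With \<open>h\<close> the identity this says that an orbit survives
  a perturbation; with a displacement \<open>h\<close> it transports a cycle.\<close>

lemma funpow_semiconj_orbit:
  assumes "\<And>x. x \<in> orbit f a \<Longrightarrow> g (h x) = h (f x)"
  shows "(g ^^ i) (h a) = h ((f ^^ i) a)"
  by (induction i) (simp_all add: assms funpow_in_orbit)

lemma orbit_semiconj:
  assumes "\<And>x. x \<in> orbit f a \<Longrightarrow> g (h x) = h (f x)"
  shows "orbit g (h a) = h ` orbit f a"
proof -
  have "(g ^^ i) (h a) = h ((f ^^ i) a)" for i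
    using assms by (rule funpow_semiconj_orbit)
  then show ?thesis
    unfolding orbit_def by (simp add: image_image)
qed

lemma funpow_cong_orbit:
  assumes "\<And>x. x \<in> orbit f a \<Longrightarrow> g x = f x"
  shows "(g ^^ i) a = (f ^^ i) a"
  using funpow_semiconj_orbit[of f a g "\<lambda>x. x" i] assms by simp

lemma orbit_cong:
  assumes "\<And>x. x \<in> orbit f a \<Longrightarrow> g x = f x"
  shows "orbit g a = orbit f a"
  using orbit_semiconj[of f a g "\<lambda>x. x"] assms by simp

lemma orbit_eq_image_period:
  assumes "(f ^^ m) a = a" "m > 0"
  shows "orbit f a = (\<lambda>i. (f ^^ i) a) ` {..<m}"
proof -
  have "(f ^^ i) a \<in> (\<lambda>i. (f ^^ i) a) ` {..<m}" for i
    using funpow_mod_eq[OF assms(1), of i] assms(2)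
    by (metis imageI lessThan_iff mod_less_divisor)
  then show ?thesis
    unfolding orbit_def by blast
qed

text \<open>From \<open>b\<close> at position \<open>i\<close>, another \<open>m - i\<close> steps
  lead back to \<open>a\<close>, so the two orbits contain each other. Hence periodic orbits with a
  common point coincide, which later identifies every newly created cycle.\<close>

lemma orbit_periodic:
  assumes "(f ^^ m) a = a" "m > 0" "b \<in> orbit f a"
  shows "(f ^^ m) b = b" "orbit f b = orbit f a"
proof -
  obtain i where i: "i < m" "b = (f ^^ i) a"
    using assms orbit_eq_image_period by (metis (no_types, lifting) imageE lessThan_iff)
  show b: "(f ^^ m) b = b"
  proof -
    have "(f ^^ m) b = (f ^^ (m + i)) a"
      unfolding funpow_add i(2) by simp
    also have "\<dots> = (f ^^ (i + m)) a"
      by (simp only: add.commute)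
    also have "\<dots> = b"
      unfolding funpow_add i(2) using assms(1) by simp
    finally show ?thesis .
  qed
  have "(f ^^ (m - i)) b = (f ^^ (m - i + i)) a"
    unfolding funpow_add i(2) by simp
  then have a: "a \<in> orbit f b"
    using i(1) assms(1) funpow_in_orbit[of "m - i" f b] by (simp del: funpow.simps)
  have "orbit f x \<subseteq> orbit f y" if "x \<in> orbit f y" for x y
    using that image_in_orbit by (intro orbit_subset) auto
  then show "orbit f b = orbit f a"
    using assms(3) a by blast
qed

lemma orbit_periodic_preimage:
  assumes "(f ^^ m) a = a" "m > 0" "b \<in> orbit f a"
  obtains x where "x \<in> orbit f a" "f x = b"
proof
  show "(f ^^ (m - 1)) b \<in> orbit f a"
    using orbit_periodic(2)[OF assms] funpow_in_orbit by metis
  have "f ((f ^^ (m - 1)) b) = (f ^^ Suc (m - 1)) b"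
    by simp
  also have "\<dots> = b"
    using orbit_periodic(1)[OF assms] assms(2) by simp
  finally show "f ((f ^^ (m - 1)) b) = b" .
qed

section \<open>Derivatives of iterates, and multipliers as products along cycles\<close>

lemma holomorphic_funpow:
  assumes "f holomorphic_on UNIV"
  shows "(f ^^ n) holomorphic_on UNIV"
proof (induction n)
  case 0
  then show ?case by (simp add: id_def)
next
  case (Suc n)
  then show ?case
    unfolding funpow.simps by (rule holomorphic_on_compose[OF _ holomorphic_on_subset[OF assms]]) simp
qed

lemma deriv_funpow:
  assumes "f holomorphic_on UNIV"
  shows "deriv (f ^^ n) a = (\<Prod>i<n. deriv f ((f ^^ i) a))"
proof (induction n)
  case 0
  then show ?case by (simp add: id_def)
next
  case (Suc n)
  have "deriv (f \<circ> (f ^^ n)) a = deriv f ((f ^^ n) a) * deriv (f ^^ n) a"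
    by (intro deriv_chain holomorphic_on_imp_differentiable_at[of _ UNIV] holomorphic_funpow assms) auto
  then show ?case
    unfolding funpow.simps Suc by (simp only: prod.lessThan_Suc mult.commute)
qed

lemma exact_period:
  assumes "periodic_point f a"
  shows "exact_period f a > 0" "(f ^^ exact_period f a) a = a"
  using LeastI_ex[of "\<lambda>n. n > 0 \<and> (f ^^ n) a = a"] assms
  unfolding exact_period_def periodic_point_def by auto

lemma finite_orbit: "periodic_point f a \<Longrightarrow> finite (orbit f a)"
  using orbit_eq_image_period[OF exact_period(2,1)] by (metis finite_imageI finite_lessThan)

text \<open>This is the chain rule, with the product over times turned into a product over a set;
  minimality of the exact period makes the iterates distinct. In this form the multiplier depends
  only on the orbit as a set and on the derivatives there.\<close>

lemma multiplier_eq_prod_orbit: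
  assumes f: "f holomorphic_on UNIV" and a: "periodic_point f a"
  shows "multiplier f a = (\<Prod>x\<in>orbit f a. deriv f x)"
proof -
  define m where "m = exact_period f a"
  have m: "m > 0" "(f ^^ m) a = a"
    using exact_period[OF a] by (auto simp: m_def)
  have neq: "(f ^^ i) a \<noteq> (f ^^ j) a" if "i < j" "j < m" for i j
  proof
    assume eq: "(f ^^ i) a = (f ^^ j) a"
    \<comment> \<open>Going on for \<open>m - j\<close> steps from the repeated point returns to
      \<open>a\<close>, so \<open>m - j + i\<close>, which is less than \<open>m\<close>, would
      already be a period.\<close>
    have "(f ^^ (m - j + i)) a = (f ^^ (m - j)) ((f ^^ j) a)"
      unfolding funpow_add by (simp add: eq)
    also have "\<dots> = (f ^^ (m - j + j)) a"
      unfolding funpow_add by simp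
    also have "\<dots> = a"
      using that m by simp
    finally have "(f ^^ (m - j + i)) a = a" .
    moreover have "m - j + i < exact_period f a" "m - j + i > 0"
      using that by (auto simp: m_def)
    ultimately show False
      unfolding exact_period_def using not_less_Least by blast
  qed
  have "inj_on (\<lambda>i. (f ^^ i) a) {..<m}"
    by (intro linorder_inj_onI) (use neq in auto)
  then show ?thesis
    unfolding multiplier_def m_def[symmetric] orbit_eq_image_period[OF m(2,1)] deriv_funpow[OF f]
    by (simp add: prod.reindex)
qed

text \<open>With \<open>m\<close> the exact period, the \<open>n\<close>-th iterate of
  \<open>f ^^ m\<close> is the identity and so has derivative 1. Since \<open>f ^^ m\<close> fixes
  \<open>a\<close>, the chain rule gives the \<open>n\<close>-th power of the multiplier for the
  same derivative.\<close>

lemma multiplier_root_of_unity: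
  assumes f: "f holomorphic_on UNIV" and "n > 0" and id: "\<And>z. (f ^^ n) z = z"
  shows "multiplier f a ^ n = 1"
proof -
  have a: "periodic_point f a"
    using assms unfolding periodic_point_def by auto
  define m where "m = exact_period f a"
  have m: "m > 0" "(f ^^ m) a = a"
    using exact_period[OF a] by (auto simp: m_def)
  have fix_a: "((f ^^ m) ^^ i) a = a" for i
    by (induction i) (use m in auto)
  have "(f ^^ m) ^^ n = (f ^^ n) ^^ m"
    by (simp add: funpow_mult mult.commute)
  moreover have "f ^^ n = id"
    using id by (auto simp: fun_eq_iff)
  moreover have "(id :: complex \<Rightarrow> complex) ^^ m = id"
    by (induction m) auto
  ultimately have "(f ^^ m) ^^ n = (\<lambda>z. z)"
    by (simp only: id_def)
  then have "deriv ((f ^^ m) ^^ n) a = 1"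
    by simp
  moreover have "deriv ((f ^^ m) ^^ n) a = (deriv (f ^^ m) a) ^ n"
    unfolding deriv_funpow[OF holomorphic_funpow[OF f]] fix_a by simp
  ultimately show ?thesis
    unfolding multiplier_def m_def by simp
qed

section \<open>Hermite interpolation of null data\<close>

text \<open>The uniform degree bound turns this into convergence in a finite-dimensional space of
  polynomials. It therefore controls values at moving points, derivatives and every seminorm
  \<open>p n\<close>.\<close>

definition coeffs_tendsto :: "(nat \<Rightarrow> complex poly) \<Rightarrow> complex poly \<Rightarrow> bool" where
  "coeffs_tendsto q r \<longleftrightarrow> (\<exists>D. \<forall>s. degree (q s) \<le> D) \<and> (\<forall>k. (\<lambda>s. coeff (q s) k) \<longlonglongrightarrow> coeff r k)"

lemma coeffs_tendsto_const: "coeffs_tendsto (\<lambda>s. q) q"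
  unfolding coeffs_tendsto_def by auto

lemma coeffs_tendsto_add:
  assumes "coeffs_tendsto q r" "coeffs_tendsto q' r'"
  shows "coeffs_tendsto (\<lambda>s. q s + q' s) (r + r')"
  unfolding coeffs_tendsto_def
proof safe
  obtain D D' where "\<forall>s. degree (q s) \<le> D" "\<forall>s. degree (q' s) \<le> D'"
    using assms unfolding coeffs_tendsto_def by blast
  then have "\<forall>s. degree (q s + q' s) \<le> max D D'"
    by (meson degree_add_le le_max_iff_disj)
  then show "\<exists>D. \<forall>s. degree (q s + q' s) \<le> D" by blast
next
  fix k
  show "(\<lambda>s. coeff (q s + q' s) k) \<longlonglongrightarrow> coeff (r + r') k"
    using assms unfolding coeffs_tendsto_def by (auto intro: tendsto_add)
qed

lemma coeffs_tendsto_mult: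
  assumes "coeffs_tendsto q r" "coeffs_tendsto q' r'"
  shows "coeffs_tendsto (\<lambda>s. q s * q' s) (r * r')"
  unfolding coeffs_tendsto_def
proof safe
  obtain D D' where "\<forall>s. degree (q s) \<le> D" "\<forall>s. degree (q' s) \<le> D'"
    using assms unfolding coeffs_tendsto_def by blast
  then have "\<forall>s. degree (q s * q' s) \<le> D + D'"
    by (meson degree_mult_le add_mono order_trans)
  then show "\<exists>D. \<forall>s. degree (q s * q' s) \<le> D" by blast
next
  fix k
  show "(\<lambda>s. coeff (q s * q' s) k) \<longlonglongrightarrow> coeff (r * r') k"
    using assms unfolding coeffs_tendsto_def coeff_mult by (auto intro!: tendsto_intros)
qed

lemma coeffs_tendsto_pderiv:
  assumes "coeffs_tendsto q r"
  shows "coeffs_tendsto (\<lambda>s. pderiv (q s)) (pderiv r)"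
  unfolding coeffs_tendsto_def
proof safe
  obtain D where "\<forall>s. degree (q s) \<le> D"
    using assms unfolding coeffs_tendsto_def by blast
  then have "\<forall>s. degree (pderiv (q s)) \<le> D"
    by (metis degree_pderiv diff_le_self le_trans)
  then show "\<exists>D. \<forall>s. degree (pderiv (q s)) \<le> D" by blast
next
  fix k
  show "(\<lambda>s. coeff (pderiv (q s)) k) \<longlonglongrightarrow> coeff (pderiv r) k"
    using assms unfolding coeffs_tendsto_def coeff_pderiv by (auto intro!: tendsto_intros)
qed

lemma coeffs_tendsto_linear:
  assumes "a \<longlonglongrightarrow> a0" "b \<longlonglongrightarrow> b0"
  shows "coeffs_tendsto (\<lambda>s. [:a s, b s:]) [:a0, b0:]"
  unfolding coeffs_tendsto_def
proof safe
  show "\<exists>D. \<forall>s. degree [:a s, b s:] \<le> D"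
    by (intro exI[of _ 1]) auto
next
  fix k
  show "(\<lambda>s. coeff [:a s, b s:] k) \<longlonglongrightarrow> coeff [:a0, b0:] k"
    using assms by (auto simp: coeff_pCons split: nat.splits)
qed

lemma coeffs_tendsto_prod:
  assumes "\<And>i. i \<in> S \<Longrightarrow> coeffs_tendsto (q i) (r i)"
  shows "coeffs_tendsto (\<lambda>s. \<Prod>i\<in>S. q i s) (\<Prod>i\<in>S. r i)"
  using assms
  by (induction S rule: infinite_finite_induct) (auto intro: coeffs_tendsto_const coeffs_tendsto_mult)

lemma poly_eq_sum_atMost:
  fixes q :: "complex poly"
  assumes "degree q \<le> D"
  shows "poly q z = (\<Sum>k\<le>D. coeff q k * z ^ k)"
  unfolding poly_altdef
  using assms by (intro sum.mono_neutral_left) (auto simp: coeff_eq_0)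

lemma coeffs_tendsto_poly:
  assumes "coeffs_tendsto q r" "x \<longlonglongrightarrow> x0"
  shows "(\<lambda>s. poly (q s) (x s)) \<longlonglongrightarrow> poly r x0"
proof -
  obtain D where D: "\<forall>s. degree (q s) \<le> D"
    using assms unfolding coeffs_tendsto_def by blast
  define D' where "D' = max D (degree r)"
  have "poly (q s) z = (\<Sum>k\<le>D'. coeff (q s) k * z ^ k)" for s z
    by (rule poly_eq_sum_atMost) (use D in \<open>auto simp: D'_def le_max_iff_disj\<close>)
  moreover have "poly r z = (\<Sum>k\<le>D'. coeff r k * z ^ k)" for z
    by (rule poly_eq_sum_atMost) (auto simp: D'_def)
  ultimately show ?thesis
    using assms unfolding coeffs_tendsto_def by (auto intro!: tendsto_intros)
qed

text \<open>Newton's form: the datum at a new node is matched by a multiple of the product of the squared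
  factors of the old nodes, and the two coefficients of that multiple are quotients of null sequences
  by sequences bounded away from zero.\<close>

lemma hermite_interpolation_null_sequence:
  fixes x u w :: "'i \<Rightarrow> nat \<Rightarrow> complex" and c :: "'i \<Rightarrow> complex"
  assumes "finite S" "inj_on c S"
    and "\<And>i. i \<in> S \<Longrightarrow> x i \<longlonglongrightarrow> c i"
    and "\<And>i. i \<in> S \<Longrightarrow> u i \<longlonglongrightarrow> 0"
    and "\<And>i. i \<in> S \<Longrightarrow> w i \<longlonglongrightarrow> 0"
  obtains q where "coeffs_tendsto q 0"
    "\<forall>\<^sub>F s in sequentially. \<forall>i\<in>S. poly (q s) (x i s) = u i s \<and> poly (pderiv (q s)) (x i s) = w i s"
  using assms
proof (induction S arbitrary: thesis rule: finite_induct)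
  case empty
  show ?case
    by (rule empty(1)[of "\<lambda>s. 0"]) (auto intro: coeffs_tendsto_const)
next
  case (insert j S)
  obtain r where r: "coeffs_tendsto r 0"
    and r_eq: "\<forall>\<^sub>F s in sequentially. \<forall>i\<in>S. poly (r s) (x i s) = u i s \<and> poly (pderiv (r s)) (x i s) = w i s"
    by (rule insert.IH) (use insert.prems in auto)
  define Q where "Q = (\<lambda>s. \<Prod>i\<in>S. [:- x i s, 1:] * [:- x i s, 1:])"
  define Q0 where "Q0 = (\<Prod>i\<in>S. [:- c i, 1:] * [:- c i, 1:])"
  have Q: "coeffs_tendsto Q Q0"
    unfolding Q_def Q0_def
    by (intro coeffs_tendsto_prod coeffs_tendsto_mult coeffs_tendsto_linear tendsto_minus)
      (use insert.prems in auto)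
  have xj: "x j \<longlonglongrightarrow> c j"
    using insert.prems by auto
  have Q0: "poly Q0 (c j) \<noteq> 0"
    using insert.prems(2) insert.hyps unfolding Q0_def poly_prod poly_mult by auto
  have Qj: "(\<lambda>s. poly (Q s) (x j s)) \<longlonglongrightarrow> poly Q0 (c j)"
    by (rule coeffs_tendsto_poly[OF Q xj])
  define \<alpha> where "\<alpha> = (\<lambda>s. (u j s - poly (r s) (x j s)) / poly (Q s) (x j s))"
  define \<beta> where "\<beta> = (\<lambda>s. (w j s - poly (pderiv (r s)) (x j s) - \<alpha> s * poly (pderiv (Q s)) (x j s))
    / poly (Q s) (x j s))"
  \<comment> \<open>The last factor is the linear polynomial
    \<open>\<alpha> s + \<beta> s * (z - x j s)\<close>, so that \<open>\<alpha>\<close> adjusts the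
    value at the new node and \<open>\<beta>\<close> then adjusts the derivative without touching
    the value.\<close>
  define q where "q = (\<lambda>s. r s + Q s * [:\<alpha> s - \<beta> s * x j s, \<beta> s:])"
  have "\<alpha> \<longlonglongrightarrow> (0 - poly 0 (c j)) / poly Q0 (c j)"
    unfolding \<alpha>_def by (intro tendsto_intros coeffs_tendsto_poly r Q xj Q0) (use insert.prems in auto)
  then have \<alpha>: "\<alpha> \<longlonglongrightarrow> 0" by simp
  have "\<beta> \<longlonglongrightarrow> (0 - poly (pderiv 0) (c j) - 0 * poly (pderiv Q0) (c j)) / poly Q0 (c j)"
    unfolding \<beta>_def
    by (intro tendsto_intros coeffs_tendsto_poly coeffs_tendsto_pderiv r Q xj Q0 \<alpha>) (use insert.prems in auto)
  then have \<beta>: "\<beta> \<longlonglongrightarrow> 0" by simp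
  have "coeffs_tendsto q (0 + Q0 * [:0 - 0 * c j, 0:])"
    unfolding q_def
    by (intro coeffs_tendsto_add r coeffs_tendsto_mult Q coeffs_tendsto_linear tendsto_intros \<alpha> \<beta> xj)
  then have q: "coeffs_tendsto q 0" by simp
  have "\<forall>\<^sub>F s in sequentially. poly (Q s) (x j s) \<noteq> 0"
    by (rule tendsto_imp_eventually_ne[OF Qj Q0])
  with r_eq have "\<forall>\<^sub>F s in sequentially. \<forall>i\<in>insert j S.
    poly (q s) (x i s) = u i s \<and> poly (pderiv (q s)) (x i s) = w i s"
  proof eventually_elim
    case (elim s)
    have "poly (q s) (x i s) = u i s \<and> poly (pderiv (q s)) (x i s) = w i s" if "i \<in> S" for i
    proof -
      \<comment> \<open>Splitting off the double root at \<open>x i s\<close> shows that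
        \<open>Q s\<close> and its derivative vanish there, so the correction leaves the data at the
        old nodes intact.\<close>
      have Qs: "Q s = [:- x i s, 1:] * [:- x i s, 1:] * (\<Prod>i\<in>S - {i}. [:- x i s, 1:] * [:- x i s, 1:])"
        unfolding Q_def using insert.hyps that by (simp only: prod.remove)
      have "poly (Q s) (x i s) = 0"
        unfolding Qs by simp
      moreover have "poly (pderiv (Q s)) (x i s) = 0"
        unfolding Qs pderiv_mult by (simp add: pderiv_pCons)
      ultimately show ?thesis
        using elim that unfolding q_def pderiv_mult pderiv_add poly_add poly_mult by simp
    qed
    moreover have "poly [:\<alpha> s - \<beta> s * x j s, \<beta> s:] (x j s) = \<alpha> s"
      by simp
    then have "poly (q s) (x j s) = u j s"
      using elim(2) unfolding q_def poly_add poly_mult by (simp add: \<alpha>_def)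
    moreover have "poly (pderiv (q s)) (x j s)
        = poly (pderiv (r s)) (x j s) + (poly (Q s) (x j s) * \<beta> s + \<alpha> s * poly (pderiv (Q s)) (x j s))"
      unfolding q_def pderiv_mult pderiv_add poly_add poly_mult by (simp add: pderiv_pCons algebra_simps)
    moreover have "poly (Q s) (x j s) * \<beta> s = w j s - poly (pderiv (r s)) (x j s) - \<alpha> s * poly (pderiv (Q s)) (x j s)"
      using elim(2) by (simp add: \<beta>_def)
    ultimately show ?case by auto
  qed
  then show ?case
    using q insert.prems(1) by blast
qed

section \<open>Limits of entire maps\<close>

text \<open>In the induction step the images of \<open>K\<close> under \<open>g k ^^ n\<close>
  eventually stay in one compact ball. There \<open>f\<close> is uniformly continuous and
  \<open>g k\<close> is uniformly close to \<open>f\<close>, and the two errors add up.\<close>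

lemma uniform_limit_funpow:
  fixes f :: "complex \<Rightarrow> complex"
  assumes f: "continuous_on UNIV f"
    and lim: "\<And>K. compact K \<Longrightarrow> uniform_limit K g f sequentially"
    and "compact K"
  shows "uniform_limit K (\<lambda>k. g k ^^ n) (f ^^ n) sequentially"
proof (induction n)
  case 0
  show ?case
    by (simp add: uniform_limit_const)
next
  case (Suc n)
  have "continuous_on UNIV (f ^^ n)"
    by (induction n) (auto simp: id_def intro!: continuous_on_compose2[OF f])
  then have "compact ((f ^^ n) ` K)"
    using \<open>compact K\<close> by (meson compact_continuous_image continuous_on_subset subset_UNIV)
  then have "bounded ((f ^^ n) ` K)"
    by (rule compact_imp_bounded)
  then obtain R where R: "\<And>z. z \<in> K \<Longrightarrow> norm ((f ^^ n) z) \<le> R"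
    unfolding bounded_iff by blast
  \<comment> \<open>The radius exceeds the bound for the limit iterate by 1, which leaves room for
    the approximating iterates.\<close>
  define L where "L = cball (0::complex) (R + 1)"
  have L: "compact L" by (simp add: L_def)
  have "\<forall>\<^sub>F k in sequentially. \<forall>z\<in>K. dist ((g k ^^ n) z) ((f ^^ n) z) < 1"
    using uniform_limitD[OF Suc.IH, of 1] by simp
  then have ev: "\<forall>\<^sub>F k in sequentially. \<forall>z\<in>K. (g k ^^ n) z \<in> L"
  proof eventually_elim
    case (elim k)
    have "norm ((g k ^^ n) z) \<le> R + 1" if "z \<in> K" for z
      using R[OF that] elim[rule_format, OF that] norm_triangle_sub[of "(g k ^^ n) z" "(f ^^ n) z"]
      by (simp add: dist_norm)
    then show ?case by (simp add: L_def)
  qed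
  have "uniformly_continuous_on L f"
    using L f by (meson compact_uniformly_continuous continuous_on_subset subset_UNIV)
  then have lim1: "uniform_limit K (\<lambda>k z. f ((g k ^^ n) z)) (\<lambda>z. f ((f ^^ n) z)) sequentially"
    using uniform_limit_compose_uniformly_continuous_on[OF Suc.IH _ ev] compact_imp_closed[OF L] by blast
  show ?case
  proof (rule uniform_limitI)
    fix e :: real assume "e > 0"
    then have "\<forall>\<^sub>F k in sequentially. \<forall>z\<in>K. dist (f ((g k ^^ n) z)) (f ((f ^^ n) z)) < e / 2"
      "\<forall>\<^sub>F k in sequentially. \<forall>z\<in>L. dist (g k z) (f z) < e / 2"
      using uniform_limitD[OF lim1, of "e / 2"] uniform_limitD[OF lim[OF L], of "e / 2"] by auto
    with ev show "\<forall>\<^sub>F k in sequentially. \<forall>z\<in>K. dist ((g k ^^ Suc n) z) ((f ^^ Suc n) z) < e"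
    proof eventually_elim
      case (elim k)
      show ?case
      proof
        fix z assume "z \<in> K"
        then show "dist ((g k ^^ Suc n) z) ((f ^^ Suc n) z) < e"
          using elim dist_triangle_half_r[of "f ((g k ^^ n) z)" "g k ((g k ^^ n) z)" e "f ((f ^^ n) z)"]
          by (simp add: dist_commute)
      qed
    qed
  qed
qed

text \<open>Otherwise some subsequence has no zeros in \<open>U\<close>, and Hurwitz's theorem on a
  ball around \<open>w\<close> contradicts \<open>h w = 0\<close>. The point \<open>z0\<close>
  excludes a constant limit: by the identity theorem \<open>h\<close> would vanish
  everywhere.\<close>

lemma Hurwitz_eventually_zero:
  fixes h :: "complex \<Rightarrow> complex"
  assumes g: "\<And>k. g k holomorphic_on UNIV" and h: "h holomorphic_on UNIV"
    and lim: "\<And>K. compact K \<Longrightarrow> uniform_limit K g h sequentially"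
    and "h w = 0" "h z0 \<noteq> 0" and U: "open U" "w \<in> U"
  shows "\<forall>\<^sub>F k in sequentially. \<exists>z\<in>U. g k z = 0"
proof (rule ccontr)
  assume "\<not> ?thesis"
  then have "\<exists>\<^sub>F k in sequentially. \<not> (\<exists>z\<in>U. g k z = 0)"
    by (simp add: not_eventually)
  then have "infinite {k. \<not> (\<exists>z\<in>U. g k z = 0)}"
    by (simp add: cofinite_eq_sequentially[symmetric] frequently_cofinite)
  then obtain \<sigma> :: "nat \<Rightarrow> nat" where \<sigma>: "strict_mono \<sigma>" "\<And>k. \<sigma> k \<in> {k. \<not> (\<exists>z\<in>U. g k z = 0)}"
    using infinite_enumerate by blast
  obtain r where r: "r > 0" "ball w r \<subseteq> U"
    using U openE by blast
  have "h w \<noteq> 0"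
  proof (rule Hurwitz_no_zeros[of "ball w r" "\<lambda>k. g (\<sigma> k)" h])
    show "uniform_limit K (\<lambda>k. g (\<sigma> k)) h sequentially" if "compact K" for K
      using filterlim_compose[OF lim[OF that] filterlim_subseq[OF \<sigma>(1)]] by simp
    show "\<not> h constant_on ball w r"
    proof
      assume "h constant_on ball w r"
      then have "h z = 0" if "z \<in> ball w r" for z
        using that \<open>r > 0\<close> \<open>h w = 0\<close> unfolding constant_on_def by (metis centre_in_ball)
      then have "h z0 = 0"
        using analytic_continuation_open[of "ball w r" UNIV h "\<lambda>_. 0" z0] h \<open>r > 0\<close> by auto
      then show False using \<open>h z0 \<noteq> 0\<close> by simp
    qed
    show "g (\<sigma> k) z \<noteq> 0" if "z \<in> ball w r" for k z
      using \<sigma>(2)[of k] that r by auto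
    show "g (\<sigma> k) holomorphic_on ball w r" for k
      using holomorphic_on_subset[OF g] by simp
    show "h holomorphic_on ball w r"
      using holomorphic_on_subset[OF h] by simp
  qed (use r in auto)
  then show False using \<open>h w = 0\<close> by simp
qed

lemma isolated_zero_open:
  fixes h :: "complex \<Rightarrow> complex"
  assumes h: "h holomorphic_on UNIV" and "h w = 0" "h z0 \<noteq> 0"
  obtains U where "open U" "w \<in> U" "\<And>z. z \<in> U \<Longrightarrow> h z = 0 \<Longrightarrow> z = w"
proof -
  obtain r where "r > 0" "\<And>z. z \<in> ball w r - {w} \<Longrightarrow> h z \<noteq> 0"
    using isolated_zeros[OF h, of w z0] assms by auto
  then show ?thesis
    by (intro that[of "ball w r"]) auto
qed

section \<open>Polynomial perturbations in a Frechet space of entire maps\<close>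

text \<open>A nonempty open subset of the plane is infinite, so removing finitely many points leaves
  a nonempty open set. This supplies all the points of \<open>E\<close> and \<open>\<Lambda>\<close>
  that have to avoid finitely many bad positions.\<close>

lemma dense_meets_open_minus_finite:
  fixes D U :: "complex set"
  assumes "closure D = UNIV" "open U" "U \<noteq> {}" "finite S"
  obtains y where "y \<in> D" "y \<in> U" "y \<notin> S"
proof -
  have "open (U - S)"
    using assms by (simp add: open_Diff finite_imp_closed)
  moreover have "U - S \<noteq> {}"
    using assms finite_imp_not_open by (metis Diff_eq_empty_iff finite_subset)
  ultimately have "D \<inter> (U - S) \<noteq> {}"
    using assms(1) open_Int_closure_eq_empty[of "U - S" D] by auto
  then show ?thesis
    using that by blast
qed

locale entire_frechet_space =
  fixes F :: "(complex \<Rightarrow> complex) set" and p :: "nat \<Rightarrow> (complex \<Rightarrow> complex) \<Rightarrow> real"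
  assumes frechet: "frechet_entire_space F p"
    and poly_mem: "poly q \<in> F"
    and finer: "finer_than_local_uniform F p"
begin

section \<open>Vector space operations and seminorm inequalities in \<open>F\<close>\<close>

lemma holo: "f \<in> F \<Longrightarrow> f holomorphic_on UNIV"
  using frechet unfolding frechet_entire_space_def by blast

lemma zero_mem: "(\<lambda>z. 0) \<in> F"
  using frechet unfolding frechet_entire_space_def by blast

lemma add_mem: "f \<in> F \<Longrightarrow> g \<in> F \<Longrightarrow> (\<lambda>z. f z + g z) \<in> F"
  using frechet unfolding frechet_entire_space_def by blast

lemma scale_mem: "f \<in> F \<Longrightarrow> (\<lambda>z. c * f z) \<in> F"
  using frechet unfolding frechet_entire_space_def by blast

lemma diff_mem: "f \<in> F \<Longrightarrow> g \<in> F \<Longrightarrow> (\<lambda>z. f z - g z) \<in> F"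
  using add_mem[of f "\<lambda>z. - 1 * g z"] scale_mem[of g "-1"] by simp

lemma seminorm: "is_seminorm_on F (p n)"
  using frechet unfolding frechet_entire_space_def by blast

lemma seminorm_nonneg: "f \<in> F \<Longrightarrow> p n f \<ge> 0"
  using seminorm unfolding is_seminorm_on_def by blast

lemma seminorm_scale: "f \<in> F \<Longrightarrow> p n (\<lambda>z. c * f z) = cmod c * p n f"
  using seminorm unfolding is_seminorm_on_def by blast

lemma seminorm_add: "f \<in> F \<Longrightarrow> g \<in> F \<Longrightarrow> p n (\<lambda>z. f z + g z) \<le> p n f + p n g"
  using seminorm unfolding is_seminorm_on_def by blast

lemma seminorm_zero: "p n (\<lambda>z. 0) = 0"
  using seminorm_scale[OF zero_mem, of n 0] by simp

lemma seminorm_diff_commute: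
  assumes "f \<in> F" "g \<in> F"
  shows "p n (\<lambda>z. f z - g z) = p n (\<lambda>z. g z - f z)"
  using seminorm_scale[OF diff_mem[OF assms], of n "-1"] by simp

lemma seminorm_diff_triangle:
  assumes "f \<in> F" "g \<in> F" "h \<in> F"
  shows "p n (\<lambda>z. f z - h z) \<le> p n (\<lambda>z. f z - g z) + p n (\<lambda>z. g z - h z)"
  using seminorm_add[OF diff_mem[OF assms(1,2)] diff_mem[OF assms(2,3)]] by simp

lemma seminorm_sum:
  assumes "finite S" "\<And>i. i \<in> S \<Longrightarrow> f i \<in> F"
  shows "(\<lambda>z. \<Sum>i\<in>S. f i z) \<in> F \<and> p n (\<lambda>z. \<Sum>i\<in>S. f i z) \<le> (\<Sum>i\<in>S. p n (f i))"
  using assms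
proof (induction S rule: finite_induct)
  case empty
  then show ?case by (simp add: zero_mem seminorm_zero)
next
  case (insert j S)
  then have "f j \<in> F" and IH: "(\<lambda>z. \<Sum>i\<in>S. f i z) \<in> F"
    "p n (\<lambda>z. \<Sum>i\<in>S. f i z) \<le> (\<Sum>i\<in>S. p n (f i))"
    by auto
  then show ?case
    using insert.hyps add_mem[OF \<open>f j \<in> F\<close> IH(1)] seminorm_add[OF \<open>f j \<in> F\<close> IH(1), of n] by simp
qed

text \<open>Subadditivity bounds \<open>p n\<close> by a finite combination of the absolute values
  of the coefficients, with the seminorms of the monomials as weights. No relation between
  \<open>p n\<close> and the size of a polynomial on compact sets is needed.\<close>

lemma seminorm_poly_tendsto_zero:
  assumes "coeffs_tendsto q 0"
  shows "(\<lambda>s. p n (poly (q s))) \<longlonglongrightarrow> 0"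
proof -
  obtain D where D: "\<And>s. degree (q s) \<le> D"
    using assms unfolding coeffs_tendsto_def by blast
  have pow: "(\<lambda>z. z ^ k) \<in> F" for k
  proof -
    have "poly (monom 1 k) = (\<lambda>z :: complex. z ^ k)"
      by (rule ext) (simp add: poly_monom)
    then show ?thesis
      using poly_mem[of "monom 1 k"] by metis
  qed
  have le: "p n (poly (q s)) \<le> (\<Sum>k\<le>D. cmod (coeff (q s) k) * p n (\<lambda>z. z ^ k))" for s
  proof -
    have "poly (q s) = (\<lambda>z. \<Sum>k\<le>D. coeff (q s) k * z ^ k)"
      using poly_eq_sum_atMost[OF D] by blast
    then have "p n (poly (q s)) \<le> (\<Sum>k\<le>D. p n (\<lambda>z. coeff (q s) k * z ^ k))"
      using seminorm_sum[of "{..D}" "\<lambda>k z. coeff (q s) k * z ^ k" n] scale_mem[OF pow] by simp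
    then show ?thesis
      by (simp add: seminorm_scale[OF pow])
  qed
  have "(\<lambda>s. \<Sum>k\<le>D. cmod (coeff (q s) k) * p n (\<lambda>z. z ^ k)) \<longlonglongrightarrow> (\<Sum>k\<le>D. cmod 0 * p n (\<lambda>z. z ^ k))"
    using assms unfolding coeffs_tendsto_def by (intro tendsto_intros) auto
  then have "(\<lambda>s. \<Sum>k\<le>D. cmod (coeff (q s) k) * p n (\<lambda>z. z ^ k)) \<longlonglongrightarrow> 0"
    by simp
  then show ?thesis
    by (rule tendsto_sandwich[rotated 3, of _ _ _ "\<lambda>_. 0"])
      (auto intro: always_eventually le seminorm_nonneg poly_mem)
qed

text \<open>One \<open>\<delta>\<close> must serve all data simultaneously. If none did, there would
  be data at distance below \<open>1 / (s + 1)\<close> without a suitable polynomial for every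
  \<open>s\<close>; Hermite interpolation along this sequence yields polynomials tending to 0, a
  contradiction.\<close>

lemma polynomial_perturbation:
  assumes f: "f \<in> F" and fin: "finite A" "finite X" "A \<inter> X = {}" and "\<epsilon> > 0"
  obtains \<delta> where "\<delta> > 0"
    "\<And>y v d. (\<And>x. x \<in> X \<Longrightarrow> dist (y x) x < \<delta> \<and> dist (v x) (f x) < \<delta> \<and> dist (d x) (deriv f x) < \<delta>) \<Longrightarrow>
      \<exists>q. (\<forall>n\<le>N. p n (poly q) < \<epsilon>) \<and> (\<forall>a\<in>A. poly q a = 0 \<and> poly (pderiv q) a = 0) \<and>
        (\<forall>x\<in>X. f (y x) + poly q (y x) = v x \<and> deriv f (y x) + poly (pderiv q) (y x) = d x)"
proof -
  define near where "near = (\<lambda>\<delta> y v d. \<forall>x\<in>X. dist (y x) x < \<delta> \<and> dist (v x) (f x) < \<delta> \<and> dist (d x) (deriv f x) < \<delta>)"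
  define good where "good = (\<lambda>y v d q. (\<forall>n\<le>N. p n (poly q) < \<epsilon>) \<and> (\<forall>a\<in>A. poly q a = 0 \<and> poly (pderiv q) a = 0) \<and>
        (\<forall>x\<in>X. f (y x) + poly q (y x) = v x \<and> deriv f (y x) + poly (pderiv q) (y x) = d x))"
  have "\<exists>\<delta>>0. \<forall>y v d. near \<delta> y v d \<longrightarrow> (\<exists>q. good y v d q)"
  proof (rule ccontr)
    assume neg: "\<not> ?thesis"
    have "\<forall>s::nat. \<exists>y v d. near (inverse (real (Suc s))) y v d \<and> (\<forall>q. \<not> good y v d q)"
    proof
      fix s :: nat
      have "inverse (real (Suc s)) > 0" by simp
      then have "\<not> (\<forall>y v d. near (inverse (real (Suc s))) y v d \<longrightarrow> (\<exists>q. good y v d q))"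
        using neg by blast
      then show "\<exists>y v d. near (inverse (real (Suc s))) y v d \<and> (\<forall>q. \<not> good y v d q)"
        by blast
    qed
    then obtain y v d where y_near: "\<And>s. near (inverse (real (Suc s))) (y s) (v s) (d s)"
      and bad: "\<And>s q. \<not> good (y s) (v s) (d s) q"
      by metis
    have null: "t \<longlonglongrightarrow> l" if "\<And>s. dist (t s) l < inverse (real (Suc s))" for t :: "nat \<Rightarrow> complex" and l
    proof -
      have "(\<lambda>s. dist (t s) l) \<longlonglongrightarrow> 0"
      proof (rule tendsto_sandwich[OF _ _ tendsto_const LIMSEQ_inverse_real_of_nat])
        show "\<forall>\<^sub>F s in sequentially. dist (t s) l \<le> inverse (real (Suc s))"
          using less_imp_le[OF that] by (simp add: always_eventually)
      qed simp
      then show ?thesis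
        by (rule iffD2[OF tendsto_dist_iff])
    qed
    have y: "(\<lambda>s. y s x) \<longlonglongrightarrow> x" and v: "(\<lambda>s. v s x) \<longlonglongrightarrow> f x" and d: "(\<lambda>s. d s x) \<longlonglongrightarrow> deriv f x"
      if "x \<in> X" for x
      using y_near that unfolding near_def by (auto intro!: null)
    have "isCont f x" "isCont (deriv f) x" for x
      using holo[OF f] holomorphic_deriv[OF holo[OF f] open_UNIV]
      by (auto simp: continuous_on_eq_continuous_at dest!: holomorphic_on_imp_continuous_on)
    then have fy: "(\<lambda>s. f (y s x)) \<longlonglongrightarrow> f x" "(\<lambda>s. deriv f (y s x)) \<longlonglongrightarrow> deriv f x" if "x \<in> X" for x
      using isCont_tendsto_compose y[OF that] by blast+
    \<comment> \<open>Nodes in \<open>A\<close> stay fixed and carry zero data. Nodes from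
      \<open>X\<close> move, and their data are the differences between the targets and
      \<open>f\<close>, which tend to 0 because \<open>f\<close> and \<open>deriv f\<close> are
      continuous.\<close>
    obtain q where q: "coeffs_tendsto q 0"
      and ev: "\<forall>\<^sub>F s in sequentially. \<forall>i\<in>A \<union> X.
        poly (q s) (if i \<in> A then i else y s i) = (if i \<in> A then 0 else v s i - f (y s i)) \<and>
        poly (pderiv (q s)) (if i \<in> A then i else y s i) = (if i \<in> A then 0 else d s i - deriv f (y s i))"
    proof (rule hermite_interpolation_null_sequence[of "A \<union> X" id "\<lambda>i s. if i \<in> A then i else y s i"
          "\<lambda>i s. if i \<in> A then 0 else v s i - f (y s i)" "\<lambda>i s. if i \<in> A then 0 else d s i - deriv f (y s i)"])
      show "(\<lambda>s. if i \<in> A then i else y s i) \<longlonglongrightarrow> id i" if "i \<in> A \<union> X" for i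
        using y[of i] that by (cases "i \<in> A") auto
      show "(\<lambda>s. if i \<in> A then 0 else v s i - f (y s i)) \<longlonglongrightarrow> 0" if "i \<in> A \<union> X" for i
        using tendsto_diff[OF v fy(1), of i i] that by (cases "i \<in> A") auto
      show "(\<lambda>s. if i \<in> A then 0 else d s i - deriv f (y s i)) \<longlonglongrightarrow> 0" if "i \<in> A \<union> X" for i
        using tendsto_diff[OF d fy(2), of i i] that by (cases "i \<in> A") auto
    qed (use fin in auto)
    have "\<forall>\<^sub>F s in sequentially. p n (poly (q s)) < \<epsilon>" for n
      by (rule order_tendstoD(2)[OF seminorm_poly_tendsto_zero[OF q] \<open>\<epsilon> > 0\<close>])
    then have "\<forall>\<^sub>F s in sequentially. \<forall>n\<in>{..N}. p n (poly (q s)) < \<epsilon>"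
      by (intro eventually_ball_finite) auto
    with ev have "\<forall>\<^sub>F s in sequentially. good (y s) (v s) (d s) (q s)"
    proof eventually_elim
      case (elim s)
      have "poly (q s) a = 0 \<and> poly (pderiv (q s)) a = 0" if "a \<in> A" for a
        using elim(1)[rule_format, of a] that by simp
      moreover have "f (y s x) + poly (q s) (y s x) = v s x \<and>
          deriv f (y s x) + poly (pderiv (q s)) (y s x) = d s x" if "x \<in> X" for x
      proof -
        have "x \<notin> A" using fin that by auto
        then show ?thesis
          using elim(1)[rule_format, of x] that by simp
      qed
      ultimately show ?case
        using elim(2) by (simp add: good_def)
    qed
    then obtain s where "good (y s) (v s) (d s) (q s)"
      unfolding eventually_sequentially by blast
    then show False
      using bad[of s "q s"] by blast
  qed
  then obtain \<delta> where \<delta>: "\<delta> > 0" "\<And>y v d. near \<delta> y v d \<Longrightarrow> \<exists>q. good y v d q"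
    by blast
  show thesis
    by (rule that[OF \<delta>(1)], rule \<delta>(2)[unfolded good_def]) (simp add: near_def)
qed

text \<open>The steps add up to at most \<open>\<epsilon> / 2\<close>; the other half is spent on
  the passage to the limit. The range \<open>n \<le> N + k\<close> grows with \<open>k\<close>, so
  every seminorm is eventually controlled and completeness applies.\<close>

lemma fast_cauchy_limit:
  assumes mem: "\<And>k. f k \<in> F" and "\<epsilon> > 0"
    and step: "\<And>k n. n \<le> N + k \<Longrightarrow> p n (\<lambda>z. f (Suc k) z - f k z) < \<epsilon> / 2 ^ (k + 2)"
  obtains g where "g \<in> F" "\<And>n. n \<le> N \<Longrightarrow> p n (\<lambda>z. g z - f 0 z) < \<epsilon>"
    "\<And>K. compact K \<Longrightarrow> uniform_limit K f g sequentially"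
proof -
  \<comment> \<open>The right-hand side is the exact value of the partial geometric sum, which lets
    the induction close.\<close>
  have diff: "p n (\<lambda>z. f (i + m) z - f i z) \<le> \<epsilon> / 2 ^ (i + 1) * (1 - 1 / 2 ^ m)" if "n \<le> N + i" for n i m
  proof (induction m)
    case 0
    then show ?case by (simp add: seminorm_zero)
  next
    case (Suc m)
    have "p n (\<lambda>z. f (i + Suc m) z - f i z) \<le> p n (\<lambda>z. f (Suc (i + m)) z - f (i + m) z) + p n (\<lambda>z. f (i + m) z - f i z)"
      using seminorm_diff_triangle[OF mem mem mem] by simp
    also have "\<dots> \<le> \<epsilon> / 2 ^ (i + m + 2) + \<epsilon> / 2 ^ (i + 1) * (1 - 1 / 2 ^ m)"
      by (intro add_mono Suc less_imp_le[OF step]) (use that in auto)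
    also have "\<dots> = \<epsilon> / 2 ^ (i + 1) * (1 - 1 / 2 ^ Suc m)"
      by (simp add: power_add field_simps)
    finally show ?case .
  qed
  have bound: "p n (\<lambda>z. f j z - f i z) \<le> \<epsilon> / 2 ^ (i + 1)" if "n \<le> N + i" "i \<le> j" for n i j
  proof -
    have "\<epsilon> / 2 ^ (i + 1) * (1 - 1 / 2 ^ (j - i)) \<le> \<epsilon> / 2 ^ (i + 1) * 1"
      using \<open>\<epsilon> > 0\<close> by (intro mult_left_mono) auto
    then show ?thesis
      using diff[of n i "j - i"] that by simp
  qed
  have "\<exists>M. \<forall>i\<ge>M. \<forall>j\<ge>M. p n (\<lambda>z. f i z - f j z) < e" if "e > 0" for n e
  proof -
    have "(\<lambda>i. \<epsilon> / 2 ^ (i + 1)) \<longlonglongrightarrow> 0"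
      by real_asymp
    then have "\<forall>\<^sub>F i in sequentially. \<epsilon> / 2 ^ (i + 1) < e"
      using order_tendstoD(2) that by blast
    then obtain M0 where M0: "\<And>i. i \<ge> M0 \<Longrightarrow> \<epsilon> / 2 ^ (i + 1) < e"
      unfolding eventually_sequentially by blast
    have "p n (\<lambda>z. f i z - f j z) < e" if "i \<ge> max M0 n" "j \<ge> max M0 n" for i j
    proof (cases "i \<le> j")
      case True
      then show ?thesis
        using bound[of n i j] M0[of i] that seminorm_diff_commute[OF mem mem, of n i j] by simp
    next
      case False
      then show ?thesis
        using bound[of n j i] M0[of j] that by simp
    qed
    then show ?thesis by blast
  qed
  obtain g where g: "g \<in> F" "\<And>n. (\<lambda>i. p n (\<lambda>z. f i z - g z)) \<longlonglongrightarrow> 0"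
  proof -
    have "\<forall>x. (\<forall>i. x i \<in> F) \<longrightarrow>
        (\<forall>n. \<forall>e>0. \<exists>M. \<forall>i\<ge>M. \<forall>j\<ge>M. p n (\<lambda>z. x i z - x j z) < e) \<longrightarrow>
        (\<exists>g\<in>F. \<forall>n. (\<lambda>i. p n (\<lambda>z. x i z - g z)) \<longlonglongrightarrow> 0)"
      using frechet unfolding frechet_entire_space_def by blast
    from this[rule_format, of f] show thesis
      using mem that \<open>\<And>n e. e > 0 \<Longrightarrow> \<exists>M. \<forall>i\<ge>M. \<forall>j\<ge>M. p n (\<lambda>z. f i z - f j z) < e\<close> by blast
  qed
  have "p n (\<lambda>z. g z - f 0 z) < \<epsilon>" if "n \<le> N" for n
  proof -
    have "\<forall>\<^sub>F i in sequentially. p n (\<lambda>z. f i z - g z) < \<epsilon> / 2"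
      using order_tendstoD(2)[OF g(2), of "\<epsilon> / 2"] \<open>\<epsilon> > 0\<close> by simp
    then obtain i where i: "p n (\<lambda>z. f i z - g z) < \<epsilon> / 2"
      unfolding eventually_sequentially by blast
    have "p n (\<lambda>z. g z - f 0 z) \<le> p n (\<lambda>z. g z - f i z) + p n (\<lambda>z. f i z - f 0 z)"
      by (rule seminorm_diff_triangle[OF g(1) mem mem])
    then show ?thesis
      using bound[of n 0 i] that i seminorm_diff_commute[OF g(1) mem, of n i] by simp
  qed
  moreover have "uniform_limit K f g sequentially" if "compact K" for K
  proof (rule uniform_limitI)
    fix e :: real assume "e > 0"
    obtain M d where "d > 0" and Md: "\<And>h. h \<in> F \<Longrightarrow> \<forall>n\<le>M. p n h < d \<Longrightarrow> \<forall>z\<in>K. cmod (h z) < e"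
    proof -
      have "\<exists>M. \<exists>d>0. \<forall>h\<in>F. (\<forall>n\<le>M. p n h < d) \<longrightarrow> (\<forall>z\<in>K. cmod (h z) < e)"
        using finer \<open>compact K\<close> \<open>e > 0\<close> unfolding finer_than_local_uniform_def by blast
      then show thesis
        using that by blast
    qed
    have "\<forall>\<^sub>F i in sequentially. \<forall>n\<in>{..M}. p n (\<lambda>z. f i z - g z) < d"
      using order_tendstoD(2)[OF g(2) \<open>d > 0\<close>] by (intro eventually_ball_finite) auto
    then show "\<forall>\<^sub>F i in sequentially. \<forall>z\<in>K. dist (f i z) (g z) < e"
    proof eventually_elim
      case (elim i)
      then show ?case
        using Md[OF diff_mem[OF mem g(1)], of i] by (simp add: dist_norm)
    qed
  qed
  ultimately show ?thesis
    using that g(1) by blast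
qed

end

section \<open>Marking points\<close>

locale cycle_prescription = entire_frechet_space +
  fixes E \<Lambda> :: "complex set"
  assumes countable_E: "countable E" and dense_E: "closure E = UNIV"
    and dense_\<Lambda>: "closure \<Lambda> = UNIV" and \<Lambda>_nonzero: "0 \<notin> \<Lambda>" and \<Lambda>_nonunit: "\<Lambda> \<inter> sphere 0 1 = {}"
begin

text \<open>The set \<open>A\<close> need not be forward invariant: its images only have to lie in
  \<open>E\<close>. Nonzero derivatives ensure that the multiplier of a partly marked cycle can
  still be adjusted at an unmarked point.\<close>

definition admissible :: "(complex \<Rightarrow> complex) \<Rightarrow> complex set \<Rightarrow> bool" where
  "admissible f A \<longleftrightarrow> f \<in> F \<and> finite A \<and> A \<subseteq> E \<and> f ` A \<subseteq> E \<and> (\<forall>a\<in>A. deriv f a \<noteq> 0) \<and>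
    (\<forall>a. periodic_point f a \<longrightarrow> orbit f a \<subseteq> A \<longrightarrow> multiplier f a \<in> \<Lambda>)"

text \<open>Derivatives are frozen together with values, so cycles of marked points keep their
  multipliers through all later steps.\<close>

definition refines ::
  "nat \<Rightarrow> real \<Rightarrow> (complex \<Rightarrow> complex) \<Rightarrow> complex set \<Rightarrow> (complex \<Rightarrow> complex) \<Rightarrow> complex set \<Rightarrow> bool" where
  "refines N \<epsilon> f A g B \<longleftrightarrow> A \<subseteq> B \<and> (\<forall>n\<le>N. p n (\<lambda>z. g z - f z) < \<epsilon>) \<and>
    (\<forall>a\<in>A. g a = f a \<and> deriv g a = deriv f a)"

text \<open>These are the cycles whose multipliers are not inherited from the map before the
  perturbation.\<close>

definition new_cycles_ok where
  "new_cycles_ok g A Y \<longleftrightarrow> (\<forall>a m. m > 0 \<longrightarrow> (g ^^ m) a = a \<longrightarrow> orbit g a \<subseteq> A \<union> Y \<longrightarrow>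
    orbit g a \<inter> Y \<noteq> {} \<longrightarrow> multiplier g a \<in> \<Lambda>)"

text \<open>Data for a perturbation of \<^term>\<open>f\<close>: each \<^term>\<open>x \<in> X\<close> is moved to \<^term>\<open>y x\<close>, where the perturbed map
  takes the value \<^term>\<open>v x\<close> and has derivative \<^term>\<open>d x\<close>.\<close>

definition close_data where
  "close_data \<delta> f X y v d \<longleftrightarrow> (\<forall>x\<in>X. dist (y x) x < \<delta> \<and> dist (v x) (f x) < \<delta> \<and>
    dist (d x) (deriv f x) < \<delta> \<and> y x \<in> E \<and> v x \<in> E \<and> d x \<noteq> 0)"

text \<open>The cycle condition remains a premise, since checking it depends on how the data were
  chosen: two of the constructions create no new cycle, the third creates exactly one.\<close>

definition realizes where
  "realizes N \<epsilon> f A X y v d g \<longleftrightarrow> g \<in> F \<and> refines N \<epsilon> f A g (A \<union> y ` X) \<and>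
    (\<forall>x\<in>X. g (y x) = v x \<and> deriv g (y x) = d x) \<and>
    (new_cycles_ok g A (y ` X) \<longrightarrow> admissible g (A \<union> y ` X))"

lemma refines_refl: "\<epsilon> > 0 \<Longrightarrow> refines N \<epsilon> f A f A"
  unfolding refines_def by (simp add: seminorm_zero)

lemma multiplier_cong_orbit:
  assumes "f \<in> F" "g \<in> F" "periodic_point g a"
    and eq: "\<And>x. x \<in> orbit g a \<Longrightarrow> f x = g x \<and> deriv f x = deriv g x"
  shows "periodic_point f a" "orbit f a = orbit g a" "multiplier f a = multiplier g a"
proof -
  have pow: "(f ^^ n) a = (g ^^ n) a" for n
    using eq by (intro funpow_cong_orbit) auto
  show per: "periodic_point f a"
    using assms(3) unfolding periodic_point_def pow .
  show orb: "orbit f a = orbit g a"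
    using eq by (intro orbit_cong) auto
  show "multiplier f a = multiplier g a"
    unfolding multiplier_eq_prod_orbit[OF holo[OF assms(1)] per]
      multiplier_eq_prod_orbit[OF holo[OF assms(2)] assms(3)] orb
    using eq by (intro prod.cong) auto
qed

text \<open>The polynomial vanishes to second order on \<open>A\<close>, so a cycle inside
  \<open>A\<close> is also a cycle of \<open>f\<close> with the same multiplier. Only cycles through
  moved points are left to the caller.\<close>

lemma refine_with_data:
  assumes adm: "admissible f A" and X: "finite X" "A \<inter> X = {}" and "\<epsilon> > 0"
  obtains \<delta> where "\<delta> > 0" "\<And>y v d. close_data \<delta> f X y v d \<Longrightarrow> \<exists>g. realizes N \<epsilon> f A X y v d g"
proof -
  have f: "f \<in> F" and A: "finite A" "A \<subseteq> E" "f ` A \<subseteq> E" "\<And>a. a \<in> A \<Longrightarrow> deriv f a \<noteq> 0"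
    and cyc: "\<And>a. periodic_point f a \<Longrightarrow> orbit f a \<subseteq> A \<Longrightarrow> multiplier f a \<in> \<Lambda>"
    using adm unfolding admissible_def by auto
  obtain \<delta> where "\<delta> > 0" and \<delta>:
    "\<And>y v d. (\<And>x. x \<in> X \<Longrightarrow> dist (y x) x < \<delta> \<and> dist (v x) (f x) < \<delta> \<and> dist (d x) (deriv f x) < \<delta>) \<Longrightarrow>
      \<exists>q. (\<forall>n\<le>N. p n (poly q) < \<epsilon>) \<and> (\<forall>a\<in>A. poly q a = 0 \<and> poly (pderiv q) a = 0) \<and>
        (\<forall>x\<in>X. f (y x) + poly q (y x) = v x \<and> deriv f (y x) + poly (pderiv q) (y x) = d x)"
    using polynomial_perturbation[OF f A(1) X \<open>\<epsilon> > 0\<close>, of N] by blast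
  show thesis
  proof (rule that[OF \<open>\<delta> > 0\<close>])
    fix y v d :: "complex \<Rightarrow> complex"
    assume "close_data \<delta> f X y v d"
    then have data: "dist (y x) x < \<delta> \<and> dist (v x) (f x) < \<delta> \<and> dist (d x) (deriv f x) < \<delta>
        \<and> y x \<in> E \<and> v x \<in> E \<and> d x \<noteq> 0" if "x \<in> X" for x
      using that unfolding close_data_def by blast
    obtain q where q: "\<And>n. n \<le> N \<Longrightarrow> p n (poly q) < \<epsilon>"
      and qA: "\<And>a. a \<in> A \<Longrightarrow> poly q a = 0 \<and> poly (pderiv q) a = 0"
      and qX: "\<And>x. x \<in> X \<Longrightarrow> f (y x) + poly q (y x) = v x \<and> deriv f (y x) + poly (pderiv q) (y x) = d x"
      using \<delta>[of y v d] data by blast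
    define g where "g = (\<lambda>z. f z + poly q z)"
    have g: "g \<in> F"
      unfolding g_def by (rule add_mem[OF f poly_mem])
    have dg: "deriv g z = deriv f z + poly (pderiv q) z" for z
      unfolding g_def
      using holo[OF f] by (intro DERIV_imp_deriv DERIV_add poly_DERIV)
        (auto intro: holomorphic_derivI)
    have gA: "g a = f a \<and> deriv g a = deriv f a" if "a \<in> A" for a
      using qA[OF that] unfolding dg by (simp add: g_def)
    have gX: "g (y x) = v x \<and> deriv g (y x) = d x" if "x \<in> X" for x
      using qX[OF that] unfolding dg by (simp add: g_def)
    have ref: "refines N \<epsilon> f A g (A \<union> y ` X)"
      unfolding refines_def using q gA by (auto simp: g_def)
    have adm': "admissible g (A \<union> y ` X)"
      if new: "new_cycles_ok g A (y ` X)"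
      unfolding admissible_def
    proof (intro conjI allI impI)
      show "g \<in> F" by (rule g)
      show "finite (A \<union> y ` X)" using A X by simp
      show "A \<union> y ` X \<subseteq> E" using A data by auto
      show "g ` (A \<union> y ` X) \<subseteq> E" using A data gA gX by auto
      show "\<forall>a\<in>A \<union> y ` X. deriv g a \<noteq> 0" using A data gA gX by auto
      fix a assume a: "periodic_point g a" "orbit g a \<subseteq> A \<union> y ` X"
      show "multiplier g a \<in> \<Lambda>"
      proof (cases "orbit g a \<inter> y ` X = {}")
        case True
        then have sub: "orbit g a \<subseteq> A"
          using a(2) by blast
        have eq: "f x = g x \<and> deriv f x = deriv g x" if "x \<in> orbit g a" for x
          using gA[of x] sub that by auto
        show ?thesis
          using multiplier_cong_orbit[OF f g a(1) eq] cyc[of a] sub by simp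
      next
        case False
        then show ?thesis
          using new a unfolding new_cycles_ok_def periodic_point_def by blast
      qed
    qed
    show "\<exists>g. realizes N \<epsilon> f A X y v d g"
      unfolding realizes_def using g ref gX adm' by blast
  qed
qed

lemma obtain_nonzero_near:
  fixes c :: complex
  assumes "\<delta> > 0"
  obtains d where "d \<noteq> 0" "dist d c < \<delta>"
  using dense_meets_open_minus_finite[of UNIV "ball c \<delta>" "{0}"] assms by (auto simp: dist_commute)

text \<open>The new value is chosen outside the marked set, so marking \<^term>\<open>e\<close> closes no cycle.\<close>

lemma mark_point:
  assumes adm: "admissible f A" and "e \<in> E" and "\<epsilon> > 0"
  obtains g B where "admissible g B" "refines N \<epsilon> f A g B" "e \<in> B"
proof (cases "e \<in> A")
  case True
  then show ?thesis
    using that adm refines_refl[OF \<open>\<epsilon> > 0\<close>] by blast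
next
  case False
  have A: "finite A"
    using adm unfolding admissible_def by blast
  from False have disj: "A \<inter> {e} = {}" by simp
  obtain \<delta> where "\<delta> > 0" and \<delta>:
    "\<And>y v d. close_data \<delta> f {e} y v d \<Longrightarrow> \<exists>g. realizes N \<epsilon> f A {e} y v d g"
    using refine_with_data[OF adm _ disj \<open>\<epsilon> > 0\<close>, of N] by blast
  obtain v where v: "v \<in> E" "v \<in> ball (f e) \<delta>" "v \<notin> insert e A"
    using dense_meets_open_minus_finite[OF dense_E, of "ball (f e) \<delta>" "insert e A"] A \<open>\<delta> > 0\<close> by auto
  obtain d where d: "d \<noteq> 0" "dist d (deriv f e) < \<delta>"
    using obtain_nonzero_near[OF \<open>\<delta> > 0\<close>] by blast
  obtain g where g: "refines N \<epsilon> f A g (A \<union> {e})" "g e = v"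
    and adm_g: "new_cycles_ok g A {e} \<Longrightarrow> admissible g (A \<union> {e})"
  proof -
    have "close_data \<delta> f {e} (\<lambda>x. x) (\<lambda>_. v) (\<lambda>_. d)"
      unfolding close_data_def using v d \<open>\<delta> > 0\<close> \<open>e \<in> E\<close> by (simp add: dist_commute)
    from \<delta>[OF this] obtain g where "realizes N \<epsilon> f A {e} (\<lambda>x. x) (\<lambda>_. v) (\<lambda>_. d) g"
      by blast
    then show thesis
      using that[of g] unfolding realizes_def by simp
  qed
  have "\<not> (orbit g a \<subseteq> A \<union> {e} \<and> orbit g a \<inter> {e} \<noteq> {})" for a
    using image_in_orbit[of e g a] g(2) v(3) by auto
  then have "admissible g (A \<union> {e})"
    using adm_g unfolding new_cycles_ok_def by blast
  then show ?thesis
    using that g by blast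
qed

text \<open>The new preimage is chosen outside the images of the marked points, so it lies on no cycle of
  marked points.\<close>

lemma mark_preimage:
  assumes adm: "admissible f A" and "e \<in> E" and U: "open U" "z \<in> U" "f z = e" and "\<epsilon> > 0"
  obtains g B w where "admissible g B" "refines N \<epsilon> f A g B" "w \<in> U \<inter> B" "g w = e"
proof (cases "z \<in> A")
  case True
  then show ?thesis
    using that[of f A z] adm refines_refl[OF \<open>\<epsilon> > 0\<close>] U by blast
next
  case False
  have A: "finite A"
    using adm unfolding admissible_def by blast
  from False have disj: "A \<inter> {z} = {}" by simp
  obtain \<delta> where "\<delta> > 0" and \<delta>:
    "\<And>y v d. close_data \<delta> f {z} y v d \<Longrightarrow> \<exists>g. realizes N \<epsilon> f A {z} y v d g"
    using refine_with_data[OF adm _ disj \<open>\<epsilon> > 0\<close>, of N] by blast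
  have "open (U \<inter> ball z \<delta>)" "U \<inter> ball z \<delta> \<noteq> {}"
    using U \<open>\<delta> > 0\<close> by auto
  \<comment> \<open>Avoiding \<open>e\<close> matters too: it excludes the fixed point
    \<open>g w = w\<close>, where the predecessor of \<open>w\<close> on a cycle would be
    \<open>w\<close> itself.\<close>
  then obtain w where w: "w \<in> E" "w \<in> U \<inter> ball z \<delta>" "w \<notin> insert e (A \<union> f ` A)"
    using dense_meets_open_minus_finite[OF dense_E, of "U \<inter> ball z \<delta>" "insert e (A \<union> f ` A)"] A by auto
  obtain d where d: "d \<noteq> 0" "dist d (deriv f z) < \<delta>"
    using obtain_nonzero_near[OF \<open>\<delta> > 0\<close>] by blast
  obtain g where g: "refines N \<epsilon> f A g (A \<union> {w})" "g w = e"
    and adm_g: "new_cycles_ok g A {w} \<Longrightarrow> admissible g (A \<union> {w})"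
  proof -
    have "close_data \<delta> f {z} (\<lambda>_. w) (\<lambda>_. e) (\<lambda>_. d)"
      unfolding close_data_def using w d U \<open>\<delta> > 0\<close> \<open>e \<in> E\<close> by (simp add: dist_commute)
    from \<delta>[OF this] obtain g where "realizes N \<epsilon> f A {z} (\<lambda>_. w) (\<lambda>_. e) (\<lambda>_. d) g"
      by blast
    then show thesis
      using that[of g] unfolding realizes_def by simp
  qed
  have "False" if a: "m > 0" "(g ^^ m) a = a" "orbit g a \<subseteq> A \<union> {w}" "orbit g a \<inter> {w} \<noteq> {}" for a m
  proof -
    have "w \<in> orbit g a" using a(4) by simp
    then obtain x where x: "x \<in> orbit g a" "g x = w"
      using orbit_periodic_preimage[OF a(2,1)] by blast
    then have "x \<in> A \<or> x = w"
      using a(3) by blast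
    then show False
    proof
      assume "x \<in> A"
      then have "w = f x"
        using g(1) x(2) unfolding refines_def by auto
      then show False
        using w(3) \<open>x \<in> A\<close> by blast
    next
      assume "x = w"
      then show False
        using g(2) x(2) w(3) by simp
    qed
  qed
  then have "admissible g (A \<union> {w})"
    using adm_g unfolding new_cycles_ok_def by blast
  then show ?thesis
    using that[of g "A \<union> {w}" w] g w by blast
qed

text \<open>A small displacement \<open>h\<close> carries the cycle into \<open>E\<close>, and
  \<open>g\<close> is chosen with \<open>g (h x) = h (f x)\<close> along it, so the image is again a
  cycle. Its multiplier is brought into \<open>\<Lambda>\<close> through the derivative at a single
  unmarked point.\<close>

lemma mark_cycle:
  assumes adm: "admissible f A" and U: "open U" "z \<in> U" and z: "(f ^^ n) z = z" "n > 0" and "\<epsilon> > 0"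
  obtains g B w where "admissible g B" "refines N \<epsilon> f A g B" "w \<in> U" "orbit g w \<subseteq> B" "(g ^^ n) w = w"
proof (cases "orbit f z \<subseteq> A")
  case True
  then show ?thesis
    using that[of f A z] adm refines_refl[OF \<open>\<epsilon> > 0\<close>] U z by blast
next
  case False
  define O' where "O' = orbit f z"
  have per: "periodic_point f z"
    using z unfolding periodic_point_def by blast
  have O: "finite O'"
    unfolding O'_def by (rule finite_orbit[OF per])
  have A: "finite A" "A \<subseteq> E" "f ` A \<subseteq> E" "\<And>a. a \<in> A \<Longrightarrow> deriv f a \<noteq> 0"
    using adm unfolding admissible_def by auto
  define X where "X = O' - A"
  have X: "finite X" "A \<inter> X = {}"
    unfolding X_def using O by auto
  obtain \<delta> where "\<delta> > 0" and \<delta>: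
    "\<And>y v d. close_data \<delta> f X y v d \<Longrightarrow> \<exists>g. realizes N \<epsilon> f A X y v d g"
    using refine_with_data[OF adm X \<open>\<epsilon> > 0\<close>, of N] by blast
  obtain r where r: "r > 0" "ball z r \<subseteq> U"
    using U openE by blast
  obtain s where s: "s > 0" "\<And>x x'. x \<in> O' \<Longrightarrow> x' \<in> O' \<Longrightarrow> x \<noteq> x' \<Longrightarrow> s \<le> dist x x'"
  proof -
    have "uniform_discrete O'"
      using O uniform_discrete_finite_iff by blast
    then show thesis
      using that unfolding uniform_discrete_def by (metis linorder_not_less)
  qed
  \<comment> \<open>The three bounds keep the data admissible for the perturbation, keep the moved
    point inside \<open>U\<close>, and make \<open>h\<close> injective on the cycle.\<close>
  define \<rho> where "\<rho> = Min {\<delta>, r, s / 2}"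
  have \<rho>: "\<rho> > 0" "\<rho> \<le> \<delta>" "\<rho> \<le> r" "\<rho> \<le> s / 2"
    unfolding \<rho>_def using \<open>\<delta> > 0\<close> r s by auto
  \<comment> \<open>Points already in \<open>E\<close> stay put. Marked points and their images lie
    in \<open>E\<close>, so \<open>h\<close> fixes them and the relation
    \<open>g (h x) = h (f x)\<close> holds there because \<open>g\<close> agrees with
    \<open>f\<close> on \<open>A\<close>.\<close>
  have "\<exists>y. y \<in> E \<and> dist y x < \<rho> \<and> y \<notin> A - {x} \<and> (x \<in> E \<longrightarrow> y = x)" for x
  proof (cases "x \<in> E")
    case True
    then show ?thesis using \<rho> by auto
  next
    case False
    then show ?thesis
      using dense_meets_open_minus_finite[OF dense_E, of "ball x \<rho>" A] \<rho> A(1)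
      by (metis DiffD1 ball_eq_empty dist_commute linorder_not_less mem_ball open_ball)
  qed
  then obtain h where h: "\<And>x. h x \<in> E" "\<And>x. dist (h x) x < \<rho>" "\<And>x. h x \<notin> A - {x}" "\<And>x. x \<in> E \<Longrightarrow> h x = x"
    by metis
  have inj: "inj_on h O'"
  proof (rule inj_onI, rule ccontr)
    fix x x' assume xx': "x \<in> O'" "x' \<in> O'" "h x = h x'" "x \<noteq> x'"
    have "dist x x' \<le> dist (h x) x + dist (h x') x'"
      unfolding xx'(3) by (rule dist_triangle3)
    also have "\<dots> < s"
      using h(2)[of x] h(2)[of x'] \<rho>(4) by simp
    finally show False
      using s(2)[of x x'] xx' by simp
  qed
  have "\<forall>x. \<exists>d. d \<noteq> 0 \<and> dist d (deriv f x) < \<delta>"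
    using obtain_nonzero_near[OF \<open>\<delta> > 0\<close>] by blast
  then obtain D where D: "\<And>x. D x \<noteq> 0" "\<And>x. dist (D x) (deriv f x) < \<delta>"
    by metis
  obtain x0 where x0: "x0 \<in> X"
    using False unfolding X_def O'_def by blast
  \<comment> \<open>This collects all factors of the future multiplier except the one at
    \<open>x0\<close>; it is nonzero because marked derivatives and all \<open>D x\<close>
    are.\<close>
  define c where "c = (\<Prod>x\<in>O' \<inter> A. deriv f x) * (\<Prod>x\<in>X - {x0}. D x)"
  have c: "c \<noteq> 0"
    unfolding c_def using O X D A by auto
  \<comment> \<open>The radius is scaled by \<open>cmod c\<close> so that the prescribed derivative
    \<open>l / c\<close> is within \<open>\<delta>\<close> of \<open>deriv f x0\<close>.\<close>
  have "ball (c * deriv f x0) (cmod c * \<delta>) \<noteq> {}"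
    using c \<open>\<delta> > 0\<close> mult_pos_pos[of "cmod c" \<delta>] by (simp add: not_le)
  then obtain l where l: "l \<in> \<Lambda>" "l \<in> ball (c * deriv f x0) (cmod c * \<delta>)"
    using dense_meets_open_minus_finite[OF dense_\<Lambda>, of "ball (c * deriv f x0) (cmod c * \<delta>)" "{}"] by blast
  define d where "d = D(x0 := l / c)"
  have d: "d x \<noteq> 0 \<and> dist (d x) (deriv f x) < \<delta>" for x
  proof (cases "x = x0")
    case True
    have "l \<noteq> 0"
      using l(1) \<Lambda>_nonzero by auto
    have "cmod c * dist (l / c) (deriv f x0) = cmod (c * (l / c - deriv f x0))"
      by (simp add: dist_norm norm_mult)
    also have "\<dots> = cmod (l - c * deriv f x0)"
      using c by (simp add: algebra_simps)
    also have "\<dots> < cmod c * \<delta>"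
      using l(2) by (simp add: dist_norm norm_minus_commute)
    finally show ?thesis
      using True c \<open>l \<noteq> 0\<close> by (simp add: d_def)
  next
    case False
    then show ?thesis
      using D by (simp add: d_def)
  qed
  \<comment> \<open>Prescribing the displaced image \<open>h (f x)\<close> as the value at
    \<open>h x\<close> is what makes \<open>h\<close> a semiconjugacy on the unmarked part of the
    cycle.\<close>
  have "close_data \<delta> f X h (\<lambda>x. h (f x)) d"
    unfolding close_data_def
  proof
    fix x
    show "dist (h x) x < \<delta> \<and> dist (h (f x)) (f x) < \<delta> \<and> dist (d x) (deriv f x) < \<delta>
        \<and> h x \<in> E \<and> h (f x) \<in> E \<and> d x \<noteq> 0"
      using h(1)[of x] h(1)[of "f x"] h(2)[of x] h(2)[of "f x"] d[of x] \<rho>(2) by auto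
  qed
  from \<delta>[OF this] obtain g where g: "g \<in> F" "refines N \<epsilon> f A g (A \<union> h ` X)"
    and gX: "\<And>x. x \<in> X \<Longrightarrow> g (h x) = h (f x) \<and> deriv g (h x) = d x"
    and adm_g: "new_cycles_ok g A (h ` X) \<Longrightarrow> admissible g (A \<union> h ` X)"
    unfolding realizes_def by blast
  have gA: "g (h x) = h (f x) \<and> deriv g (h x) = deriv f x" if "x \<in> A" for x
  proof -
    have "h x = x" "h (f x) = f x"
      using that A h(4) by auto
    then show ?thesis
      using g(2) that unfolding refines_def by auto
  qed
  have semi: "g (h x) = h (f x)" if "x \<in> orbit f z" for x
    using gA[of x] gX[of x] that unfolding X_def O'_def by blast
  have orb: "orbit g (h z) = h ` O'"
    unfolding O'_def using semi by (intro orbit_semiconj) auto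
  have "(g ^^ n) (h z) = h ((f ^^ n) z)"
    using semi by (intro funpow_semiconj_orbit) auto
  then have gz: "(g ^^ n) (h z) = h z"
    using z by simp
  have hO: "h ` O' \<subseteq> A \<union> h ` X"
  proof
    fix w assume "w \<in> h ` O'"
    then obtain x where x: "x \<in> O'" "w = h x" by blast
    show "w \<in> A \<union> h ` X"
    proof (cases "x \<in> A")
      case True
      then show ?thesis using h(4) A x by auto
    next
      case False
      then show ?thesis using x X_def by auto
    qed
  qed
  have prod: "(\<Prod>w\<in>h ` O'. deriv g w) = l"
  proof -
    have split: "O' = (O' \<inter> A) \<union> X" "(O' \<inter> A) \<inter> X = {}"
      unfolding X_def by auto
    have "(\<Prod>w\<in>h ` O'. deriv g w) = (\<Prod>x\<in>O'. deriv g (h x))"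
      using prod.reindex[OF inj] by simp
    also have "\<dots> = (\<Prod>x\<in>O' \<inter> A. deriv g (h x)) * (\<Prod>x\<in>X. deriv g (h x))"
      using prod.union_disjoint[OF _ X(1) split(2)] O split(1) by (metis finite_Int)
    also have "(\<Prod>x\<in>O' \<inter> A. deriv g (h x)) = (\<Prod>x\<in>O' \<inter> A. deriv f x)"
      using gA by (intro prod.cong) auto
    also have "(\<Prod>x\<in>X. deriv g (h x)) = (\<Prod>x\<in>X. d x)"
      using gX by (intro prod.cong) auto
    also have "\<dots> = d x0 * (\<Prod>x\<in>X - {x0}. d x)"
      by (rule prod.remove[OF X(1) x0])
    also have "(\<Prod>x\<in>X - {x0}. d x) = (\<Prod>x\<in>X - {x0}. D x)"
      by (intro prod.cong) (auto simp: d_def)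
    also have "(\<Prod>x\<in>O' \<inter> A. deriv f x) * (d x0 * (\<Prod>x\<in>X - {x0}. D x)) = c * d x0"
      unfolding c_def by (simp add: mult_ac)
    also have "\<dots> = l"
      using c by (simp add: d_def)
    finally show ?thesis .
  qed
  \<comment> \<open>A cycle through some point of \<open>X\<close> displaced by \<open>h\<close>
    shares that point with the moved cycle and hence equals it, so its multiplier is
    \<open>l\<close>.\<close>
  have "multiplier g a \<in> \<Lambda>"
    if a: "m > 0" "(g ^^ m) a = a" "orbit g a \<inter> h ` X \<noteq> {}" for a m
  proof -
    obtain x where x: "x \<in> X" "h x \<in> orbit g a"
      using a(3) by blast
    have "h x \<in> orbit g (h z)"
      unfolding orb using x X_def by blast
    then have "orbit g a = h ` O'"
      using orbit_periodic(2)[OF a(2,1) x(2)] orbit_periodic(2)[OF gz z(2)] orb by simp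
    moreover have "periodic_point g a"
      using a unfolding periodic_point_def by blast
    ultimately show ?thesis
      using multiplier_eq_prod_orbit[OF holo[OF g(1)]] prod l(1) by simp
  qed
  then have "admissible g (A \<union> h ` X)"
    using adm_g unfolding new_cycles_ok_def by blast
  moreover have "h z \<in> U"
    using h(2)[of z] \<rho>(3) r by (auto simp: dist_commute)
  ultimately show ?thesis
    using that[of g "A \<union> h ` X" "h z"] g(2) gz hO orb by simp
qed

end

section \<open>The limit map\<close>

datatype task = Mark complex | Preimage complex "complex set" | Cycle nat "complex set"

context cycle_prescription
begin

primrec valid :: "task \<Rightarrow> bool" where
  "valid (Mark e) \<longleftrightarrow> e \<in> E"
| "valid (Preimage e U) \<longleftrightarrow> e \<in> E \<and> open U"
| "valid (Cycle n U) \<longleftrightarrow> n > 0 \<and> open U"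

text \<open>Here \<open>f\<close> is the map before the step and \<open>g\<close> the map after it.
  The last two tasks are void when \<open>f\<close> has no suitable point in \<open>U\<close>, which
  is why each must be repeated at arbitrarily late stages.\<close>

primrec fulfils :: "task \<Rightarrow> (complex \<Rightarrow> complex) \<Rightarrow> (complex \<Rightarrow> complex) \<Rightarrow> complex set \<Rightarrow> bool" where
  "fulfils (Mark e) f g B \<longleftrightarrow> e \<in> B"
| "fulfils (Preimage e U) f g B \<longleftrightarrow> (\<exists>z\<in>U. f z = e) \<longrightarrow> (\<exists>w\<in>U \<inter> B. g w = e)"
| "fulfils (Cycle n U) f g B \<longleftrightarrow> (\<exists>z\<in>U. (f ^^ n) z = z) \<longrightarrow> (\<exists>w\<in>U. orbit g w \<subseteq> B \<and> (g ^^ n) w = w)"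

lemma fulfil_task:
  assumes "valid t" and adm: "admissible f A" and "\<epsilon> > 0"
  shows "\<exists>g B. admissible g B \<and> refines N \<epsilon> f A g B \<and> fulfils t f g B"
proof (cases t)
  case (Mark e)
  then show ?thesis
    using mark_point[OF adm _ \<open>\<epsilon> > 0\<close>, of e N] \<open>valid t\<close> by (metis fulfils.simps(1) valid.simps(1))
next
  case (Preimage e U)
  show ?thesis
  proof (cases "\<exists>z\<in>U. f z = e")
    case True
    then obtain z where "z \<in> U" "f z = e" by blast
    moreover have "e \<in> E" "open U"
      using \<open>valid t\<close> Preimage by auto
    ultimately obtain g B w where "admissible g B" "refines N \<epsilon> f A g B" "w \<in> U \<inter> B" "g w = e"
      using mark_preimage[OF adm _ _ _ _ \<open>\<epsilon> > 0\<close>] by metis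
    then show ?thesis
      unfolding Preimage by auto
  next
    case False
    then show ?thesis
      unfolding Preimage using adm refines_refl[OF \<open>\<epsilon> > 0\<close>, of N f A] by auto
  qed
next
  case (Cycle n U)
  show ?thesis
  proof (cases "\<exists>z\<in>U. (f ^^ n) z = z")
    case True
    then obtain z where "z \<in> U" "(f ^^ n) z = z" by blast
    moreover have "n > 0" "open U"
      using \<open>valid t\<close> Cycle by auto
    ultimately obtain g B w where "admissible g B" "refines N \<epsilon> f A g B" "w \<in> U" "orbit g w \<subseteq> B" "(g ^^ n) w = w"
      using mark_cycle[OF adm _ _ _ _ \<open>\<epsilon> > 0\<close>] by metis
    then show ?thesis
      unfolding Cycle by auto
  next
    case False
    then show ?thesis
      unfolding Cycle using adm refines_refl[OF \<open>\<epsilon> > 0\<close>, of N f A] by auto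
  qed
qed

lemma task_sequence:
  assumes "f0 \<in> F" "\<epsilon> > 0" "\<And>k. valid (t k)"
  obtains f A where "f 0 = f0" "\<And>k. admissible (f k) (A k)"
    "\<And>k. refines (N + k) (\<epsilon> / 2 ^ (k + 2)) (f k) (A k) (f (Suc k)) (A (Suc k))"
    "\<And>k. fulfils (t k) (f k) (f (Suc k)) (A (Suc k))"
proof -
  have "\<exists>s. \<forall>k. (admissible (fst (s k)) (snd (s k)) \<and> (k = 0 \<longrightarrow> fst (s k) = f0)) \<and>
      (refines (N + k) (\<epsilon> / 2 ^ (k + 2)) (fst (s k)) (snd (s k)) (fst (s (Suc k))) (snd (s (Suc k))) \<and>
      fulfils (t k) (fst (s k)) (fst (s (Suc k))) (snd (s (Suc k))))"
  proof (rule dependent_nat_choice)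
    \<comment> \<open>Every orbit contains its starting point, so no cycle lies in the empty set and
      the multiplier condition is vacuous.\<close>
    have "admissible f0 {}"
      unfolding admissible_def using assms(1) self_in_orbit by fastforce
    then show "\<exists>s. admissible (fst s) (snd s) \<and> (0 = (0::nat) \<longrightarrow> fst s = f0)"
      by (intro exI[of _ "(f0, {})"]) simp
  next
    fix s and k :: nat
    assume "admissible (fst s) (snd s) \<and> (k = 0 \<longrightarrow> fst s = f0)"
    then have "\<exists>g B. admissible g B \<and> refines (N + k) (\<epsilon> / 2 ^ (k + 2)) (fst s) (snd s) g B \<and> fulfils (t k) (fst s) g B"
      using assms by (intro fulfil_task) auto
    then obtain g B where "admissible g B" "refines (N + k) (\<epsilon> / 2 ^ (k + 2)) (fst s) (snd s) g B" "fulfils (t k) (fst s) g B"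
      by blast
    then show "\<exists>s'. (admissible (fst s') (snd s') \<and> (Suc k = 0 \<longrightarrow> fst s' = f0)) \<and>
      refines (N + k) (\<epsilon> / 2 ^ (k + 2)) (fst s) (snd s) (fst s') (snd s') \<and>
      fulfils (t k) (fst s) (fst s') (snd s')"
      by (intro exI[of _ "(g, B)"]) simp
  qed
  then obtain s where s: "\<And>k. admissible (fst (s k)) (snd (s k))" "\<And>k. k = 0 \<Longrightarrow> fst (s k) = f0"
    "\<And>k. refines (N + k) (\<epsilon> / 2 ^ (k + 2)) (fst (s k)) (snd (s k)) (fst (s (Suc k))) (snd (s (Suc k)))"
    "\<And>k. fulfils (t k) (fst (s k)) (fst (s (Suc k))) (snd (s (Suc k)))"
    by blast
  show thesis
    by (rule that[of "\<lambda>k. fst (s k)" "\<lambda>k. snd (s k)"]) (use s in auto)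
qed

lemma enumerate_tasks:
  assumes "countable \<B>" "topological_basis \<B>"
  shows "\<exists>t :: nat \<Rightarrow> task. (\<forall>k. valid (t k)) \<and> (\<forall>e\<in>E. \<forall>m. \<exists>k\<ge>m. t k = Mark e) \<and>
    (\<forall>e\<in>E. \<forall>U\<in>\<B>. \<forall>m. \<exists>k\<ge>m. t k = Preimage e U) \<and>
    (\<forall>n>0. \<forall>U\<in>\<B>. \<forall>m. \<exists>k\<ge>m. t k = Cycle n U)"
proof -
  define T where "T = Mark ` E \<union> (\<lambda>(e, U). Preimage e U) ` (E \<times> \<B>) \<union> (\<lambda>(n, U). Cycle n U) ` ({0<..} \<times> \<B>)"
  have T: "countable T"
    unfolding T_def using countable_E assms(1) by (intro countable_Un countable_image countable_SIGMA) auto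
  have "E \<noteq> {}"
    using dense_E by auto
  then have "T \<noteq> {}"
    unfolding T_def by auto
  \<comment> \<open>The second component of the decoded pair is ignored. Pairing a task with an
    arbitrary \<open>m\<close> thus gives an index at least \<open>m\<close> at which the task
    occurs.\<close>
  define t where "t = (\<lambda>k. from_nat_into T (fst (prod_decode k)))"
  have cofinal: "\<exists>k\<ge>m. t k = x" if "x \<in> T" for x m
  proof -
    have "t (prod_encode (to_nat_on T x, m)) = x"
      unfolding t_def using T that by simp
    then show ?thesis
      using le_prod_encode_2 by blast
  qed
  have "valid (t k)" for k
  proof -
    have "t k \<in> T"
      unfolding t_def using from_nat_into[OF \<open>T \<noteq> {}\<close>] by simp
    then show ?thesis
      unfolding T_def using topological_basis_open[OF assms(2)] by auto
  qed
  moreover have "Preimage e U \<in> T" if "e \<in> E" "U \<in> \<B>" for e U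
    using that unfolding T_def by auto
  moreover have "Cycle n U \<in> T" if "n > 0" "U \<in> \<B>" for n U
    using that unfolding T_def by auto
  moreover have "Mark e \<in> T" if "e \<in> E" for e
    using that unfolding T_def by auto
  ultimately show ?thesis
    using cofinal by (intro exI[of _ t]) simp
qed

lemma approximation:
  assumes "f0 \<in> F" "\<epsilon> > 0"
  obtains g where "g \<in> F" "g -` E = E" "\<And>z. periodic_point g z \<Longrightarrow> z \<in> E"
    "\<And>z. periodic_point g z \<Longrightarrow> multiplier g z \<in> \<Lambda>"
    "\<And>n. n \<le> N \<Longrightarrow> p n (\<lambda>z. g z - f0 z) < \<epsilon>"
proof -
  obtain \<B> :: "complex set set" where \<B>: "countable \<B>" "topological_basis \<B>"
    using ex_countable_basis by blast
  obtain t :: "nat \<Rightarrow> task" where t: "\<forall>k. valid (t k)" "\<forall>e\<in>E. \<forall>m. \<exists>k\<ge>m. t k = Mark e"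
    "\<forall>e\<in>E. \<forall>U\<in>\<B>. \<forall>m. \<exists>k\<ge>m. t k = Preimage e U" "\<forall>n>0. \<forall>U\<in>\<B>. \<forall>m. \<exists>k\<ge>m. t k = Cycle n U"
    using enumerate_tasks[OF \<B>] by blast
  obtain f A where f0: "f 0 = f0" and adm: "\<And>k. admissible (f k) (A k)"
    and ref: "\<And>k. refines (N + k) (\<epsilon> / 2 ^ (k + 2)) (f k) (A k) (f (Suc k)) (A (Suc k))"
    and ful: "\<And>k. fulfils (t k) (f k) (f (Suc k)) (A (Suc k))"
    by (rule task_sequence[where t = t, OF assms t(1)[rule_format], of N], rule that)
  have fF: "f k \<in> F" and A: "A k \<subseteq> E" "f k ` A k \<subseteq> E" "\<And>a. a \<in> A k \<Longrightarrow> deriv (f k) a \<noteq> 0"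
    and cyc: "\<And>a. periodic_point (f k) a \<Longrightarrow> orbit (f k) a \<subseteq> A k \<Longrightarrow> multiplier (f k) a \<in> \<Lambda>" for k
    using adm[of k] unfolding admissible_def by auto
  obtain g where g: "g \<in> F" and close: "\<And>n. n \<le> N \<Longrightarrow> p n (\<lambda>z. g z - f 0 z) < \<epsilon>"
    and lim: "\<And>K. compact K \<Longrightarrow> uniform_limit K f g sequentially"
  proof (rule fast_cauchy_limit[of f \<epsilon> N, OF fF assms(2)])
    show "p n (\<lambda>z. f (Suc k) z - f k z) < \<epsilon> / 2 ^ (k + 2)" if "n \<le> N + k" for k n
      using ref[of k] that unfolding refines_def by blast
  qed (rule that)
  have holf: "f k holomorphic_on UNIV" for k by (rule holo[OF fF])
  have holg: "g holomorphic_on UNIV" by (rule holo[OF g])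
  have mono: "A i \<subseteq> A (i + m)" for i m
  proof (induction m)
    case (Suc m)
    then show ?case
      using ref[of "i + m"] unfolding refines_def by auto
  qed simp
  then have mono_A: "A i \<subseteq> A j" if "i \<le> j" for i j
    using that by (metis le_add_diff_inverse)
  have frozen: "f (i + m) a = f i a \<and> deriv (f (i + m)) a = deriv (f i) a" if "a \<in> A i" for i m a
  proof (induction m)
    case (Suc m)
    have "a \<in> A (i + m)"
      using that mono by blast
    then show ?case
      using Suc ref[of "i + m"] unfolding refines_def by simp
  qed simp
  \<comment> \<open>From stage \<open>i\<close> on, values and derivatives at \<open>a\<close> are
    constant. Locally uniform convergence of holomorphic maps entails convergence of the
    derivatives, so both constants are attained by \<open>g\<close>.\<close>
  have g_A: "g a = f i a \<and> deriv g a = deriv (f i) a" if "a \<in> A i" for i a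
  proof
    have "(\<lambda>k. f k a) \<longlonglongrightarrow> g a"
      using tendsto_uniform_limitI[OF lim[of "{a}"], of a] by simp
    then have "(\<lambda>k. f (k + i) a) \<longlonglongrightarrow> g a"
      by (rule LIMSEQ_ignore_initial_segment)
    then have "(\<lambda>k. f i a) \<longlonglongrightarrow> g a"
      using frozen[OF that] by (simp add: add.commute)
    then show "g a = f i a"
      using LIMSEQ_unique tendsto_const by blast
    have "uniform_limit (ball a 1) f g sequentially"
      by (rule uniform_limit_on_subset[OF lim[of "cball a 1"]]) auto
    then have "(\<lambda>k. deriv (f k) a) \<longlonglongrightarrow> deriv g a"
      by (rule deriv_complex_uniform_limit) (use holomorphic_on_subset[OF holf] in auto)
    then have "(\<lambda>k. deriv (f (k + i)) a) \<longlonglongrightarrow> deriv g a"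
      by (rule LIMSEQ_ignore_initial_segment)
    then have "(\<lambda>k. deriv (f i) a) \<longlonglongrightarrow> deriv g a"
      using frozen[OF that] by (simp add: add.commute)
    then show "deriv g a = deriv (f i) a"
      using LIMSEQ_unique tendsto_const by blast
  qed
  have E_A: "\<exists>k. e \<in> A k" if e: "e \<in> E" for e
  proof -
    obtain k where "t k = Mark e"
      using t(2)[rule_format, OF e, of 0] by blast
    then show ?thesis
      using ful[of k] by auto
  qed
  have g_E: "g e \<in> E" if e: "e \<in> E" for e
  proof -
    obtain k where k: "e \<in> A k"
      using E_A[OF e] by blast
    then show ?thesis
      using g_A[OF k] A(2)[of k] by auto
  qed
  \<comment> \<open>Restricting to points of \<open>E\<close> avoids circularity: this fact is used
    in \<open>non_id\<close>, and only then can all periodic points be shown to lie in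
    \<open>E\<close>.\<close>
  have mult_E: "multiplier g z \<in> \<Lambda>" if z: "periodic_point g z" "z \<in> E" for z
  proof -
    have fin: "finite (orbit g z)"
      by (rule finite_orbit[OF z(1)])
    have sub: "orbit g z \<subseteq> E"
      by (rule orbit_subset) (use z g_E in auto)
    have "\<forall>x\<in>orbit g z. \<exists>k. x \<in> A k"
      using E_A sub by blast
    then obtain k where k: "\<And>x. x \<in> orbit g z \<Longrightarrow> x \<in> A (k x)"
      by metis
    \<comment> \<open>The orbit is finite and the sets \<open>A k\<close> increase, so a single
      stage marks all of it.\<close>
    define m where "m = Max (k ` orbit g z)"
    have m: "x \<in> A m" if "x \<in> orbit g z" for x
      using k[OF that] mono_A[of "k x" m] fin that unfolding m_def by auto
    have eq: "f m x = g x \<and> deriv (f m) x = deriv g x" if "x \<in> orbit g z" for x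
      using g_A[OF m[OF that]] by simp
    show ?thesis
      using multiplier_cong_orbit[OF fF g z(1) eq] cyc[of m z] m by auto
  qed
  obtain e0 where e0: "e0 \<in> E"
    using dense_E by fastforce
  \<comment> \<open>A marked point carries a nonzero derivative, which rules out a constant limit
    and makes the solutions of \<open>g z = e\<close> isolated.\<close>
  have nonconst: "\<exists>z. g z \<noteq> e" for e
  proof (rule ccontr)
    assume "\<not> ?thesis"
    then have "g = (\<lambda>_. e)" by auto
    then have "deriv g e0 = 0" by simp
    moreover obtain k where k: "e0 \<in> A k"
      using E_A[OF e0] by blast
    ultimately show False
      using g_A[OF k] A(3)[OF k] by simp
  qed
  have non_id: "\<exists>z. (g ^^ n) z \<noteq> z" if "n > 0" for n
  proof (rule ccontr)
    assume "\<not> ?thesis"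
    then have id: "(g ^^ n) z = z" for z by blast
    then have "multiplier g e0 \<in> \<Lambda>"
      using \<open>n > 0\<close> e0 by (intro mult_E) (auto simp: periodic_point_def)
    moreover have "cmod (multiplier g e0) = 1"
      using power_eq_1_iff[OF multiplier_root_of_unity[OF holg \<open>n > 0\<close> id, of e0]] \<open>n > 0\<close> by simp
    ultimately show False
      using \<Lambda>_nonunit by auto
  qed
  have pre_E: "w \<in> E" if w: "g w \<in> E" for w
  proof -
    define h where "h = (\<lambda>z. g z - g w)"
    have h: "h holomorphic_on UNIV"
      unfolding h_def by (intro holomorphic_intros holg)
    obtain z0 where z0: "h z0 \<noteq> 0"
      using nonconst[of "g w"] by (auto simp: h_def)
    have "h w = 0" by (simp add: h_def)
    obtain V where V: "open V" "w \<in> V" "\<And>z. z \<in> V \<Longrightarrow> h z = 0 \<Longrightarrow> z = w"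
      using isolated_zero_open[OF h \<open>h w = 0\<close> z0] by blast
    obtain U where U: "U \<in> \<B>" "w \<in> U" "U \<subseteq> V"
      using topological_basisE[OF \<B>(2) V(1,2)] by blast
    have "open U" using topological_basis_open \<B> U by blast
    have "\<forall>\<^sub>F k in sequentially. \<exists>z\<in>U. f k z - g w = 0"
    proof (rule Hurwitz_eventually_zero[OF _ h _ \<open>h w = 0\<close> z0 \<open>open U\<close> U(2)])
      show "(\<lambda>z. f k z - g w) holomorphic_on UNIV" for k
        by (intro holomorphic_intros holf)
      show "uniform_limit K (\<lambda>k z. f k z - g w) h sequentially" if "compact K" for K
        unfolding h_def by (intro uniform_limit_intros lim that)
    qed
    then obtain m where m: "\<And>k. k \<ge> m \<Longrightarrow> \<exists>z\<in>U. f k z = g w"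
      unfolding eventually_sequentially by auto
    \<comment> \<open>At this stage \<open>f k\<close> has a solution in \<open>U\<close>, so the
      task is not void and produces a marked solution for \<open>f (Suc k)\<close>. Marked values
      persist in \<open>g\<close>, and \<open>w\<close> is the only solution for \<open>g\<close> in
      \<open>U\<close>.\<close>
    obtain k where "k \<ge> m" "t k = Preimage (g w) U"
      using t(3)[rule_format, OF w U(1), of m] by blast
    then obtain z where z: "z \<in> U" "z \<in> A (Suc k)" "f (Suc k) z = g w"
      using ful[of k] m[of k] by auto
    then have "h z = 0"
      using g_A by (simp add: h_def)
    then have "z = w"
      using V(3) z(1) U(3) by blast
    then show ?thesis
      using z(2) A(1) by blast
  qed
  have per_E: "w \<in> E" if w: "periodic_point g w" for w
  proof -
    obtain n where n: "n > 0" "(g ^^ n) w = w"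
      using w unfolding periodic_point_def by blast
    define h where "h = (\<lambda>z. (g ^^ n) z - z)"
    have h: "h holomorphic_on UNIV"
      unfolding h_def by (intro holomorphic_intros holomorphic_funpow holg)
    obtain z0 where z0: "h z0 \<noteq> 0"
      using non_id[OF n(1)] by (auto simp: h_def)
    have "h w = 0" using n by (simp add: h_def)
    obtain V where V: "open V" "w \<in> V" "\<And>z. z \<in> V \<Longrightarrow> h z = 0 \<Longrightarrow> z = w"
      using isolated_zero_open[OF h \<open>h w = 0\<close> z0] by blast
    obtain U where U: "U \<in> \<B>" "w \<in> U" "U \<subseteq> V"
      using topological_basisE[OF \<B>(2) V(1,2)] by blast
    have "open U" using topological_basis_open \<B> U by blast
    have "\<forall>\<^sub>F k in sequentially. \<exists>z\<in>U. (f k ^^ n) z - z = 0"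
    proof (rule Hurwitz_eventually_zero[OF _ h _ \<open>h w = 0\<close> z0 \<open>open U\<close> U(2)])
      show "(\<lambda>z. (f k ^^ n) z - z) holomorphic_on UNIV" for k
        by (intro holomorphic_intros holomorphic_funpow holf)
      show "uniform_limit K (\<lambda>k z. (f k ^^ n) z - z) h sequentially" if "compact K" for K
        unfolding h_def
        by (intro uniform_limit_intros uniform_limit_funpow holomorphic_on_imp_continuous_on holg lim that)
    qed
    then obtain m where m: "\<And>k. k \<ge> m \<Longrightarrow> \<exists>z\<in>U. (f k ^^ n) z = z"
      unfolding eventually_sequentially by auto
    obtain k where "k \<ge> m" "t k = Cycle n U"
      using t(4)[rule_format, OF n(1) U(1), of m] by blast
    then obtain z where z: "z \<in> U" "orbit (f (Suc k)) z \<subseteq> A (Suc k)" "(f (Suc k) ^^ n) z = z"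
      using ful[of k] m[of k] by auto
    \<comment> \<open>The whole orbit is marked, hence \<open>g\<close> follows it too, and
      \<open>z\<close> is a zero of \<open>h\<close> in the isolating set.\<close>
    have "(g ^^ n) z = (f (Suc k) ^^ n) z"
      using z(2) g_A by (intro funpow_cong_orbit) blast
    then have "h z = 0"
      using z(3) by (simp add: h_def)
    then have "z = w"
      using V(3) z(1) U(3) by blast
    then show ?thesis
      using z(2) self_in_orbit[of z "f (Suc k)"] A(1)[of "Suc k"] by auto
  qed
  show thesis
  proof (rule that[OF g])
    show "g -` E = E"
      using pre_E g_E by auto
    show "p n (\<lambda>z. g z - f0 z) < \<epsilon>" if "n \<le> N" for n
      using close[OF that] unfolding f0 .
  qed (use per_E mult_E in auto)
qed

end

theorem theorem1p4:
  fixes F :: "(complex \<Rightarrow> complex) set"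
    and p :: "nat \<Rightarrow> (complex \<Rightarrow> complex) \<Rightarrow> real"
    and E \<Lambda> :: "complex set"
  assumes "frechet_entire_space F p"
    and "\<forall>q :: complex poly. poly q \<in> F"
    and "finer_than_local_uniform F p"
    and "countable E" and "closure E = UNIV"
    and "closure \<Lambda> = UNIV"
  shows "dense_in_frechet F p
           {f \<in> F. f -` E = E
                 \<and> (\<forall>z. periodic_point f z \<longrightarrow> z \<in> E)
                 \<and> (\<forall>z. periodic_point f z \<longrightarrow> multiplier f z \<in> \<Lambda>)}"
proof -
  \<comment> \<open>The set \<open>C\<close> is closed and negligible, so its complement is open and
    dense, and the part of \<open>\<Lambda>\<close> in it is still dense. Without 0 and the unit
    circle the remaining set meets the requirements of \<open>cycle_prescription\<close>.\<close>
  define C where "C = {0} \<union> sphere (0::complex) 1"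
  define \<Lambda>' where "\<Lambda>' = (- C) \<inter> \<Lambda>"
  have "negligible C"
    unfolding C_def by (intro negligible_Un negligible_sphere negligible_sing)
  then have "interior C = {}"
    using negligible_subset[OF _ interior_subset] open_not_negligible open_interior by blast
  then have "closure (- C) = UNIV"
    by (simp add: closure_complement)
  moreover have "open (- C)"
    unfolding C_def by (simp add: open_Compl closed_Un)
  ultimately have \<Lambda>': "closure \<Lambda>' = UNIV"
    unfolding \<Lambda>'_def using closure_open_Int_superset[of "- C" \<Lambda>] assms(6) by simp
  interpret cycle_prescription F p E \<Lambda>'
    by unfold_locales (use assms \<Lambda>' in \<open>auto simp: \<Lambda>'_def C_def\<close>)
  show ?thesis
    unfolding dense_in_frechet_def
  proof (intro conjI ballI allI impI)
    fix g N and e :: real assume ge: "g \<in> F" "e > 0"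
    obtain f where "f \<in> F" "f -` E = E" "\<And>z. periodic_point f z \<Longrightarrow> z \<in> E"
      "\<And>z. periodic_point f z \<Longrightarrow> multiplier f z \<in> \<Lambda>'" "\<And>n. n \<le> N \<Longrightarrow> p n (\<lambda>z. f z - g z) < e"
      by (rule approximation[OF ge, of N], rule that)
    then show "\<exists>f\<in>{f \<in> F. f -` E = E \<and> (\<forall>z. periodic_point f z \<longrightarrow> z \<in> E)
        \<and> (\<forall>z. periodic_point f z \<longrightarrow> multiplier f z \<in> \<Lambda>)}. \<forall>n\<le>N. p n (\<lambda>z. f z - g z) < e"
      unfolding \<Lambda>'_def by (intro bexI[of _ f]) auto
  qed auto
qed

end
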